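(* Let $d\ge 2$ be a fixed integer and let the prime power $q$ tend to infinity. For every integer $m \ge q^{d/(d+1)}(\log q)^3$, the number of general position sets of size $m$ in $\mathbb{F}_q^d$ is at most $\binom{(1+o(1))q}{m}$, where the $o(1)$ term tends to $0$ as $q\to\infty$ uniformly in such $m$.
   Context: $\mathbb{F}_q$ is the finite field with $q$ elements. A hyperplane in $\mathbb{F}_q^d$ is a $(d-1)$-dimensional affine subspace; a point set $P\subset\mathbb{F}_q^d$ is in general position if no $d+1$ points of $P$ lie in a common hyperplane. $\log$ is in base $2$. *)

theory Defs
  imports Complex_Main "HOL-Algebra.AbelCoset" "Jordan_Normal_Form.Missing_VectorSpace"
begin

text \<open>
  The field \<open>F\<close> is a \<open>HOL-Algebra\<close> record rather than a type of class \<open>field\<close>, because the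
  asymptotic claim quantifies over all finite fields inside the scope of the \<open>o(1)\<close> term.
  Vectors are extensional functions on \<open>{..<d}\<close>, so the space is finite when \<open>F\<close> is.
\<close>

definition coord_space :: "'a ring \<Rightarrow> nat \<Rightarrow> ('a, nat \<Rightarrow> 'a) module" where
  "coord_space F d = ring.func_space F {..<d}"

definition affine_subspace :: "'a ring \<Rightarrow> nat \<Rightarrow> nat \<Rightarrow> (nat \<Rightarrow> 'a) set \<Rightarrow> bool" where
  "affine_subspace F d k A \<longleftrightarrow>
     (\<exists>W v. VectorSpace.subspace F W (coord_space F d)
          \<and> vectorspace.dim F ((coord_space F d)\<lparr>carrier := W\<rparr>) = k
          \<and> v \<in> carrier (coord_space F d)
          \<and> A = v <+\<^bsub>coord_space F d\<^esub> W)"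

definition hyperplane :: "'a ring \<Rightarrow> nat \<Rightarrow> (nat \<Rightarrow> 'a) set \<Rightarrow> bool" where
  "hyperplane F d H \<longleftrightarrow> affine_subspace F d (d - 1) H"

definition general_position :: "'a ring \<Rightarrow> nat \<Rightarrow> (nat \<Rightarrow> 'a) set \<Rightarrow> bool" where
  "general_position F d P \<longleftrightarrow>
     P \<subseteq> carrier (coord_space F d)
     \<and> (\<nexists>H S. hyperplane F d H \<and> S \<subseteq> P \<and> card S = d + 1 \<and> S \<subseteq> H)"

definition general_position_sets :: "'a ring \<Rightarrow> nat \<Rightarrow> nat \<Rightarrow> (nat \<Rightarrow> 'a) set set" where
  "general_position_sets F d m = {P. general_position F d P \<and> card P = m}"

lemma coord_space_vectorspace:
  assumes "field F"
  shows "vectorspace F (coord_space F d)"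
proof -
  interpret field F by (rule assms)
  have "module F (coord_space F d)"
    unfolding coord_space_def by (intro cring.func_space_is_module is_cring)
  then show ?thesis
    by (intro vectorspace.intro assms)
qed

lemma card_coord_space:
  "field F \<Longrightarrow> card (carrier (coord_space F d)) = card (carrier F) ^ d"
  by (simp add: coord_space_def ring.func_space_def field.is_ring card_PiE)

lemma finite_general_position_sets:
  assumes "field F" "finite (carrier F)"
  shows "finite (general_position_sets F d m)"
proof (rule finite_subset)
  show "general_position_sets F d m \<subseteq> Pow (carrier (coord_space F d))"
    by (auto simp: general_position_sets_def general_position_def)
  show "finite (Pow (carrier (coord_space F d)))"
    using assms by (simp add: coord_space_def ring.func_space_def field.is_ring finite_PiE)
qed

end

theory Submission
  imports Defs "HOL-Analysis.Convex" "HOL-Real_Asymp.Real_Asymp"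
begin

text \<open>
  Fix a set \<open>A\<close> of \<open>a \<approx> \<surd>q\<close> points of a general position set \<open>P\<close> and join two points \<open>x \<noteq> y\<close> of
  the space when they lie in a common hyperplane with \<open>d - 1\<close> points of \<open>A\<close>; then \<open>P - A\<close> is
  independent in this graph. The pencils of \<open>q + 1\<close> hyperplanes through the \<open>(d - 1)\<close>-subsets of
  \<open>A\<close> produce many joined pairs inside every \<open>C\<close>, and since \<open>A\<close> is in general position no pair is
  counted more than \<open>d\<^sup>2 a\<^sup>d\<^sup>-\<^sup>2\<close> times. Hence every \<open>C\<close> with more than \<open>(1 + \<epsilon>)(q + 1)\<close> points has a
  vertex of degree at least \<open>\<beta>|C|\<close>, where \<open>\<beta>\<close> is of order \<open>\<epsilon> / \<surd>q\<close>, and the Kleitman--Winston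
  argument leaves only about \<open>(q\<^sup>d + 1)\<^sup>s\<close> times \<open>(1 + \<epsilon>)q choose m\<close> sets, where \<open>s\<close> is of
  order \<open>\<surd>q (log q)\<^sup>2\<close> for \<open>\<epsilon> = 1 / ln q\<close>. The first factor is absorbed by enlarging \<open>\<epsilon>\<close>,
  because \<open>m\<close> exceeds \<open>q\<^sup>2\<^sup>/\<^sup>3\<close>.
\<close>

section \<open>Counting independent sets\<close>

definition indep_sets :: "('v \<Rightarrow> 'v \<Rightarrow> bool) \<Rightarrow> 'v set \<Rightarrow> nat \<Rightarrow> 'v set set" where
  "indep_sets adj C m = {I. I \<subseteq> C \<and> card I = m \<and> (\<forall>x\<in>I. \<forall>y\<in>I. \<not> adj x y)}"

lemma finite_indep_sets: "finite C \<Longrightarrow> finite (indep_sets adj C m)"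
  by (rule finite_subset[of _ "Pow C"]) (auto simp: indep_sets_def)

lemma card_indep_sets_le_choose:
  assumes "finite C"
  shows "card (indep_sets adj C m) \<le> card C choose m"
proof -
  have "card (indep_sets adj C m) \<le> card {I. I \<subseteq> C \<and> card I = m}"
    using assms by (intro card_mono) (auto simp: indep_sets_def)
  then show ?thesis using assms by (simp add: n_subsets)
qed

text \<open>The branching step of the recursion: sets avoiding \<open>v\<close> lose one vertex of
  \<open>C\<close>, while sets through \<open>v\<close> lose all neighbours of \<open>v\<close> as
  well.\<close>

lemma card_indep_sets_Suc_le:
  assumes "finite C" "v \<in> C"
  shows "card (indep_sets adj C (Suc m))
    \<le> card (indep_sets adj (C - {v}) (Suc m)) + card (indep_sets adj (C - {v} - {y. adj v y}) m)"
proof -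
  let ?X = "indep_sets adj (C - {v}) (Suc m)"
  let ?Y = "indep_sets adj (C - {v} - {y. adj v y}) m"
  have "indep_sets adj C (Suc m) \<subseteq> ?X \<union> insert v ` ?Y"
  proof
    fix I assume I: "I \<in> indep_sets adj C (Suc m)"
    show "I \<in> ?X \<union> insert v ` ?Y"
    proof (cases "v \<in> I")
      case True
      moreover have "finite I" using I assms by (auto simp: indep_sets_def intro: finite_subset)
      ultimately have "I - {v} \<in> ?Y" "I = insert v (I - {v})"
        using I by (auto simp: indep_sets_def)
      then show ?thesis by blast
    qed (use I in \<open>auto simp: indep_sets_def\<close>)
  qed
  then have "card (indep_sets adj C (Suc m)) \<le> card (?X \<union> insert v ` ?Y)"
    using assms by (intro card_mono) (auto simp: finite_indep_sets)
  also have "\<dots> \<le> card ?X + card (insert v ` ?Y)" by (rule card_Un_le)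
  also have "card (insert v ` ?Y) \<le> card ?Y"
    using assms by (intro card_image_le) (auto simp: finite_indep_sets)
  finally show ?thesis by simp
qed

text \<open>Kleitman-Winston as a recursion. While more than \<open>R\<close> vertices remain,
  branch on a vertex of large degree. Choosing it shrinks the rest by the factor
  \<open>1 - \<beta>\<close>, so at most \<open>s\<close> choices occur before \<open>R\<close>
  vertices are left. The power pays for these choices, the binomial for the remaining part of the
  set.\<close>

lemma card_indep_sets_le:
  fixes \<beta> :: real and R :: nat
  assumes "finite C" "\<beta> \<le> 1"
    and deg: "\<And>B. B \<subseteq> C \<Longrightarrow> R < card B \<Longrightarrow>
      \<exists>v\<in>B. real (card {y \<in> B. y \<noteq> v \<and> adj v y}) \<ge> \<beta> * real (card B)"
    and "real (card C) * (1 - \<beta>) ^ s \<le> real R"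
  shows "card (indep_sets adj C m) \<le> (card C + 1) ^ s * ((R + s) choose m)"
  using assms
proof (induction "card C" arbitrary: C s m rule: less_induct)
  case less
  note fin = less.prems(1) and \<beta> = less.prems(2) and deg = less.prems(3) and size = less.prems(4)
  consider "m = 0" | "card C \<le> R" | k where "m = Suc k" "R < card C"
    by (cases m) force+
  then show ?case
  proof cases
    case 1
    then show ?thesis using card_indep_sets_le_choose[OF fin, of adj m] by (simp add: le_trans)
  next
    case 2
    have "card (indep_sets adj C m) \<le> card C choose m" by (rule card_indep_sets_le_choose[OF fin])
    also have "\<dots> \<le> (R + s) choose m" using 2 by (intro binomial_right_mono) auto
    also have "\<dots> \<le> (card C + 1) ^ s * ((R + s) choose m)" by simp
    finally show ?thesis .
  next
    case 3
    \<comment> \<open>With \<open>s = 0\<close> the hypothesis \<open>size\<close> would say that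
      \<open>C\<close> already has at most \<open>R\<close> elements.\<close>
    then have "s \<noteq> 0" using size by (cases s) auto
    then obtain t where s: "s = Suc t" using not0_implies_Suc by blast
    obtain v where v: "v \<in> C" "real (card {y \<in> C. y \<noteq> v \<and> adj v y}) \<ge> \<beta> * real (card C)"
      using deg[of C] 3 by auto
    let ?X = "C - {v}" and ?Y = "C - {v} - {y. adj v y}"
    have X: "card ?X = card C - 1" "card C > 0" using v fin by (auto simp: card_gt_0_iff)
    have "?Y \<subseteq> C - {y \<in> C. y \<noteq> v \<and> adj v y}" by auto
    then have "card ?Y \<le> card (C - {y \<in> C. y \<noteq> v \<and> adj v y})" using fin by (intro card_mono) auto
    also have "\<dots> = card C - card {y \<in> C. y \<noteq> v \<and> adj v y}"
      using fin by (intro card_Diff_subset) auto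
    finally have "card ?Y + card {y \<in> C. y \<noteq> v \<and> adj v y} \<le> card C"
      using card_mono[OF fin, of "{y \<in> C. y \<noteq> v \<and> adj v y}"] by auto
    then have "real (card ?Y) \<le> real (card C) * (1 - \<beta>)" using v by (simp add: algebra_simps)
    then have "real (card ?Y) * (1 - \<beta>) ^ t \<le> real (card C) * (1 - \<beta>) * (1 - \<beta>) ^ t"
      using \<beta> by (intro mult_right_mono) auto
    then have sizeY: "real (card ?Y) * (1 - \<beta>) ^ t \<le> real R"
      using size by (simp add: s mult.assoc)
    have sizeX: "real (card ?X) * (1 - \<beta>) ^ s \<le> real R"
    proof -
      have "real (card ?X) * (1 - \<beta>) ^ s \<le> real (card C) * (1 - \<beta>) ^ s"
        using \<beta> X by (intro mult_right_mono) auto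
      then show ?thesis using size by linarith
    qed
    have cY: "card ?Y \<le> card ?X" using fin by (intro card_mono) auto
    have "card (indep_sets adj ?X m) \<le> (card ?X + 1) ^ s * ((R + s) choose m)"
      using X fin \<beta> sizeX by (intro less.hyps) (auto intro!: deg)
    moreover have "card (indep_sets adj ?Y k) \<le> (card ?Y + 1) ^ t * ((R + t) choose k)"
      using X cY fin \<beta> sizeY by (intro less.hyps) (auto intro!: deg)
    \<comment> \<open>Choosing \<open>v\<close> uses up one unit of both \<open>s\<close> and
      \<open>m\<close>. By Pascal's rule, raising both indices of a binomial does not decrease it;
      this is why \<open>s\<close> is added to \<open>R\<close>.\<close>
    moreover have "(card ?Y + 1) ^ t * ((R + t) choose k) \<le> (card ?X + 1) ^ t * ((R + s) choose m)"
      using cY 3 by (intro mult_mono power_mono) (auto simp: s)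
    moreover have "card (indep_sets adj C m) \<le> card (indep_sets adj ?X m) + card (indep_sets adj ?Y k)"
      using card_indep_sets_Suc_le[OF fin v(1)] 3 by simp
    \<comment> \<open>Here \<open>card ?X + 1\<close> equals \<open>card C\<close>, and the
      \<open>+ 1\<close> in the base of the bound leaves room for the sum over both
      branches.\<close>
    ultimately have "card (indep_sets adj C m)
        \<le> (card C ^ s + card C ^ t) * ((R + s) choose m)"
      using X by (simp add: algebra_simps)
    also have "card C ^ s + card C ^ t = (card C + 1) * card C ^ t" by (simp add: s)
    also have "\<dots> \<le> (card C + 1) * (card C + 1) ^ t" by (intro mult_left_mono power_mono) auto
    finally show ?thesis by (simp add: s)
  qed
qed

section \<open>A vertex of large degree by double counting\<close>

lemma square_card_le_collisions:
  assumes "finite C" "card (h ` C) \<le> k"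
  shows "(card C)\<^sup>2 \<le> k * card {(x, y) \<in> C \<times> C. h x = h y}"
proof -
  let ?f = "\<lambda>z. {x \<in> C. h x = z}"
  have C: "card C = (\<Sum>z\<in>h ` C. card (?f z))"
    using assms by (subst card_UN_disjoint[symmetric]) (auto intro!: arg_cong[of _ _ card])
  have "card {(x, y) \<in> C \<times> C. h x = h y} = card (\<Union>z\<in>h ` C. ?f z \<times> ?f z)"
    by (intro arg_cong[of _ _ card]) auto
  also have "\<dots> = (\<Sum>z\<in>h ` C. card (?f z \<times> ?f z))"
    using assms by (intro card_UN_disjoint) auto
  finally have E: "card {(x, y) \<in> C \<times> C. h x = h y} = (\<Sum>z\<in>h ` C. (card (?f z))\<^sup>2)"
    by (simp add: card_cartesian_product power2_eq_square)
  have "(\<Sum>z\<in>h ` C. real (card (?f z)))\<^sup>2 \<le> (\<Sum>z\<in>h ` C. (real (card (?f z)))\<^sup>2) * (real (card (h ` C)))"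
    by (rule sum_squared_le_sum_of_squares)
  also have "\<dots> \<le> (\<Sum>z\<in>h ` C. (real (card (?f z)))\<^sup>2) * real k"
    using assms by (intro mult_left_mono sum_nonneg) auto
  finally have "real ((card C)\<^sup>2) \<le> real (k * card {(x, y) \<in> C \<times> C. h x = h y})"
    unfolding E C by (simp add: mult.commute)
  then show ?thesis by linarith
qed

text \<open>Double counting of the triples \<open>(t, x, y)\<close> off the diagonal: each
  \<open>E t\<close> supplies many pairs, and each pair is supplied by at most \<open>M\<close> of
  the \<open>t\<close>, so the average degree is already as large as claimed.\<close>

lemma ex_large_degree:
  fixes E :: "'t \<Rightarrow> 'v \<Rightarrow> 'v \<Rightarrow> bool" and k M :: nat
  assumes "finite \<T>" "finite C" "C \<noteq> {}" "k > 0"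
    and many: "\<And>t. t \<in> \<T> \<Longrightarrow> (card C)\<^sup>2 \<le> k * card {(x, y) \<in> C \<times> C. E t x y}"
    and mult: "\<And>x y. x \<in> C \<Longrightarrow> y \<in> C \<Longrightarrow> x \<noteq> y \<Longrightarrow> card {t \<in> \<T>. E t x y} \<le> M"
  shows "\<exists>v\<in>C. real M * real (card {y \<in> C. y \<noteq> v \<and> (\<exists>t\<in>\<T>. E t v y)})
    \<ge> real (card \<T>) * (real (card C) / real k - 1)"
proof (rule ccontr)
  let ?N = "\<lambda>v. {y \<in> C. y \<noteq> v \<and> (\<exists>t\<in>\<T>. E t v y)}"
  let ?b = "real (card \<T>) * (real (card C) / real k - 1)"
  let ?X = "{(t, x, y) \<in> \<T> \<times> C \<times> C. x \<noteq> y \<and> E t x y}"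
  assume "\<not> ?thesis"
  then have small: "real M * real (card (?N v)) < ?b" if "v \<in> C" for v
    using that by (meson not_le)
  have fin: "finite {(x, y) \<in> C \<times> C. P x y}" for P
    by (rule finite_subset[of _ "C \<times> C"]) (use assms(2) in auto)
  \<comment> \<open>Discarding the diagonal costs at most \<open>card C\<close> pairs, which
    produces the \<open>- 1\<close>.\<close>
  have per_t: "real (card C) * (real (card C) / real k - 1)
      \<le> real (card {(x, y) \<in> C \<times> C. x \<noteq> y \<and> E t x y})" if "t \<in> \<T>" for t
  proof -
    have "{(x, y) \<in> C \<times> C. E t x y} \<subseteq> {(x, y) \<in> C \<times> C. x \<noteq> y \<and> E t x y} \<union> (\<lambda>x. (x, x)) ` C"
      by auto
    then have "card {(x, y) \<in> C \<times> C. E t x y}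
        \<le> card ({(x, y) \<in> C \<times> C. x \<noteq> y \<and> E t x y} \<union> (\<lambda>x. (x, x)) ` C)"
      using assms(2) by (intro card_mono finite_UnI fin finite_imageI)
    also have "\<dots> \<le> card {(x, y) \<in> C \<times> C. x \<noteq> y \<and> E t x y} + card C"
      by (rule order.trans[OF card_Un_le]) (simp add: assms card_image_le)
    finally have "real (card {(x, y) \<in> C \<times> C. E t x y})
        \<le> real (card {(x, y) \<in> C \<times> C. x \<noteq> y \<and> E t x y}) + real (card C)" by linarith
    moreover have "real ((card C)\<^sup>2) \<le> real (k * card {(x, y) \<in> C \<times> C. E t x y})"
      using many[OF that] by (simp only: of_nat_le_iff)
    then have "(real (card C))\<^sup>2 / real k \<le> real (card {(x, y) \<in> C \<times> C. E t x y})"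
      using assms(4) by (simp add: pos_divide_le_eq mult.commute)
    ultimately show ?thesis by (simp add: algebra_simps power2_eq_square)
  qed
  have "card ?X = card (SIGMA t:\<T>. {(x, y) \<in> C \<times> C. x \<noteq> y \<and> E t x y})"
    by (intro arg_cong[of _ _ card]) auto
  also have "\<dots> = (\<Sum>t\<in>\<T>. card {(x, y) \<in> C \<times> C. x \<noteq> y \<and> E t x y})"
    using assms(1) fin by (intro card_SigmaI) auto
  finally have "real (card ?X) \<ge> (\<Sum>t\<in>\<T>. real (card C) * (real (card C) / real k - 1))"
    by (simp only: of_nat_sum) (intro sum_mono per_t)
  then have lower: "real (card ?X) \<ge> real (card C) * ?b" by (simp add: algebra_simps)
  \<comment> \<open>The same triples, now grouped by \<open>x\<close> and then by the neighbours
    \<open>y\<close> of \<open>x\<close>.\<close>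
  have "card ?X = card (SIGMA x:C. SIGMA y:?N x. {t \<in> \<T>. E t x y})"
    by (rule bij_betw_same_card[of "\<lambda>(t, x, y). (x, y, t)"])
       (auto simp: bij_betw_def inj_on_def image_def)
  also have "\<dots> = (\<Sum>x\<in>C. \<Sum>y\<in>?N x. card {t \<in> \<T>. E t x y})"
    using assms by simp
  also have "\<dots> \<le> (\<Sum>x\<in>C. \<Sum>y\<in>?N x. M)"
    by (intro sum_mono mult) auto
  finally have "real (card ?X) \<le> real (\<Sum>x\<in>C. \<Sum>y\<in>?N x. M)"
    by (simp only: of_nat_le_iff)
  also have "\<dots> = (\<Sum>x\<in>C. real M * real (card (?N x)))" by (simp add: mult.commute)
  also have "\<dots> < (\<Sum>x\<in>C. ?b)" using assms by (intro sum_strict_mono small) auto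
  finally show False using lower by simp
qed

section \<open>Affine functions over a finite field\<close>

context vectorspace
begin

lemma card_carrier_eq_power_dim:
  assumes "finite (carrier K)" "finite (carrier V)"
  shows "card (carrier V) = card (carrier K) ^ dim"
proof -
  have "span (carrier V) = carrier V"
    using in_own_span[of "carrier V"] span_is_subset2[of "carrier V"] by auto
  then have "fin_dim" using assms(2) by (auto simp: fin_dim_def)
  then obtain B where B: "finite B" "basis B" using finite_basis_exists by blast
  then have BV: "B \<subseteq> carrier V" by (simp add: basis_def)
  have "bij_betw (\<lambda>a. lincomb a B) (B \<rightarrow>\<^sub>E carrier K) (carrier V)"
    unfolding bij_betw_def
  proof
    have ex1: "\<exists>!a. a \<in> B \<rightarrow>\<^sub>E carrier K \<and> lincomb a B = v" if "v \<in> carrier V" for v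
      using basis_criterion[OF B(1) BV] B(2) that by blast
    have closed: "lincomb a B \<in> carrier V" if "a \<in> B \<rightarrow>\<^sub>E carrier K" for a
      using that BV by (intro lincomb_closed) auto
    show "inj_on (\<lambda>a. lincomb a B) (B \<rightarrow>\<^sub>E carrier K)"
      using ex1 closed by (intro inj_onI) metis
    show "(\<lambda>a. lincomb a B) ` (B \<rightarrow>\<^sub>E carrier K) = carrier V"
      using ex1 closed by (auto simp: image_iff) metis
  qed
  then have "card (carrier V) = card (B \<rightarrow>\<^sub>E carrier K)" by (simp add: bij_betw_same_card)
  also have "\<dots> = card (carrier K) ^ dim" using B by (simp add: card_PiE dim_basis)
  finally show ?thesis .
qed

text \<open>Rank-nullity for a linear functional on a subspace \<open>N\<close>, with cardinalities
  in place of dimensions. Every fibre of \<open>f\<close> translates into the kernel; if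
  \<open>f u0\<close> is nonzero, the sums of a multiple of \<open>u0\<close> and a kernel element
  are pairwise distinct in \<open>N\<close>.\<close>

lemma
  assumes fin: "finite (carrier K)" "finite N" and N: "N \<subseteq> carrier V"
    and closed: "\<And>r u w. r \<in> carrier K \<Longrightarrow> u \<in> N \<Longrightarrow> w \<in> N \<Longrightarrow> r \<odot>\<^bsub>V\<^esub> u \<oplus>\<^bsub>V\<^esub> w \<in> N"
    and f: "f \<in> carrier V \<rightarrow> carrier K"
    and lin: "\<And>r u w. r \<in> carrier K \<Longrightarrow> u \<in> carrier V \<Longrightarrow> w \<in> carrier V \<Longrightarrow>
      f (r \<odot>\<^bsub>V\<^esub> u \<oplus>\<^bsub>V\<^esub> w) = r \<otimes>\<^bsub>K\<^esub> f u \<oplus>\<^bsub>K\<^esub> f w"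
  shows card_le_card_kernel: "card N \<le> card (carrier K) * card {u \<in> N. f u = \<zero>\<^bsub>K\<^esub>}" (is ?le)
    and card_eq_card_kernel: "u0 \<in> N \<Longrightarrow> f u0 \<noteq> \<zero>\<^bsub>K\<^esub> \<Longrightarrow>
      card N = card (carrier K) * card {u \<in> N. f u = \<zero>\<^bsub>K\<^esub>}" (is "_ \<Longrightarrow> _ \<Longrightarrow> ?eq")
proof -
  let ?ker = "{u \<in> N. f u = \<zero>\<^bsub>K\<^esub>}"
  have fK: "f u \<in> carrier K" if "u \<in> N" for u using f N that by blast
  have fibre: "card {u \<in> N. f u = r} \<le> card ?ker" for r
  proof (cases "{u \<in> N. f u = r} = {}")
    case False
    then obtain u0 where u0: "u0 \<in> N" "f u0 = r" by blast
    \<comment> \<open>Translation by \<open>- u0\<close>, written as a linear combination so that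
      \<open>closed\<close> and \<open>lin\<close> apply.\<close>
    let ?g = "\<lambda>w. (\<ominus>\<^bsub>K\<^esub> \<one>\<^bsub>K\<^esub>) \<odot>\<^bsub>V\<^esub> u0 \<oplus>\<^bsub>V\<^esub> w"
    show ?thesis
    proof (rule card_inj_on_le[of ?g])
      show "inj_on ?g {u \<in> N. f u = r}" using u0 N by (intro inj_onI) (simp add: subset_iff)
      show "?g ` {u \<in> N. f u = r} \<subseteq> ?ker"
        using u0 N fK by (auto simp: closed lin subset_iff R.l_minus R.l_neg)
    qed (use fin in auto)
  qed (simp only: card.empty)
  have "card N \<le> card (\<Union>r\<in>carrier K. {u \<in> N. f u = r})"
    using fin fK by (intro card_mono) auto
  also have "\<dots> \<le> (\<Sum>r\<in>carrier K. card {u \<in> N. f u = r})" by (rule card_UN_le[OF fin(1)])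
  also have "\<dots> \<le> (\<Sum>r\<in>carrier K. card ?ker)" by (intro sum_mono fibre)
  finally show le: ?le by simp
  show ?eq if u0: "u0 \<in> N" "f u0 \<noteq> \<zero>\<^bsub>K\<^esub>"
  proof (rule antisym[OF le])
    let ?g = "\<lambda>(r, w). r \<odot>\<^bsub>V\<^esub> u0 \<oplus>\<^bsub>V\<^esub> w"
    have u0c: "u0 \<in> carrier V" "f u0 \<in> carrier K" using u0 N fK by auto
    have "inj_on ?g (carrier K \<times> ?ker)"
    proof (intro inj_onI, clarify)
      fix r w r' w'
      assume rw: "r \<in> carrier K" "r' \<in> carrier K" "w \<in> N" "w' \<in> N" "f w = \<zero>\<^bsub>K\<^esub>" "f w' = \<zero>\<^bsub>K\<^esub>"
        and eq: "r \<odot>\<^bsub>V\<^esub> u0 \<oplus>\<^bsub>V\<^esub> w = r' \<odot>\<^bsub>V\<^esub> u0 \<oplus>\<^bsub>V\<^esub> w'"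
      then have wV: "w \<in> carrier V" "w' \<in> carrier V" using N by auto
      have "r \<otimes>\<^bsub>K\<^esub> f u0 = r' \<otimes>\<^bsub>K\<^esub> f u0"
        using arg_cong[OF eq, of f] rw wV u0c by (simp add: lin)
      then have "r = r'" using rw u0c u0(2) by (simp add: m_rcancel)
      then show "r = r' \<and> w = w'" using eq rw wV u0c by simp
    qed
    moreover have "?g ` (carrier K \<times> ?ker) \<subseteq> N" using u0 closed by auto
    ultimately have "card (carrier K \<times> ?ker) \<le> card N" using fin by (intro card_inj_on_le)
    then show "card (carrier K) * card ?ker \<le> card N" by (simp add: card_cartesian_product)
  qed
qed

end

section \<open>Zero sets of affine functions\<close>

locale finite_affine_space = field F for F :: "'a ring" (structure) +
  fixes d :: nat
  assumes finite_carrier: "finite (carrier F)"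
begin

abbreviation "pts \<equiv> coord_space F d"
abbreviation "funs \<equiv> coord_space F (Suc d)"

text \<open>An affine function on the point space is stored as an element of \<open>F\<^sup>d\<^sup>+\<^sup>1\<close>: the
  coefficients of its linear part, followed by its constant term.\<close>

definition dot :: "(nat \<Rightarrow> 'a) \<Rightarrow> (nat \<Rightarrow> 'a) \<Rightarrow> 'a" where
  "dot u x = (\<Oplus>i\<in>{..<d}. u i \<otimes> x i)"

definition ev :: "(nat \<Rightarrow> 'a) \<Rightarrow> (nat \<Rightarrow> 'a) \<Rightarrow> 'a" where
  "ev u x = dot u x \<oplus> u d"

text \<open>The annihilator of \<open>S\<close>. For a nonempty set of points its cardinality is
  \<open>q\<close> to the power \<open>d\<close> minus the dimension of the affine hull, so affine
  dependence can be tracked through cardinalities alone.\<close>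

definition ann :: "(nat \<Rightarrow> 'a) set \<Rightarrow> (nat \<Rightarrow> 'a) set" where
  "ann S = {u \<in> carrier funs. \<forall>x\<in>S. ev u x = \<zero>}"

sublocale pts: vectorspace F pts by (rule coord_space_vectorspace[OF field_axioms])
sublocale funs: vectorspace F funs by (rule coord_space_vectorspace[OF field_axioms])

lemma coord_space_simps:
  "carrier (coord_space F n) = {..<n} \<rightarrow>\<^sub>E carrier F"
  "\<zero>\<^bsub>coord_space F n\<^esub> = (\<lambda>i\<in>{..<n}. \<zero>)"
  "x \<oplus>\<^bsub>coord_space F n\<^esub> y = (\<lambda>i\<in>{..<n}. x i \<oplus> y i)"
  "r \<odot>\<^bsub>coord_space F n\<^esub> x = (\<lambda>i\<in>{..<n}. r \<otimes> x i)"
  by (simp_all add: coord_space_def func_space_def)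

lemma finite_pts: "finite (carrier (coord_space F n))"
  using finite_carrier by (simp add: coord_space_simps finite_PiE)

lemma two_le_card: "2 \<le> card (carrier F)"
  using card_mono[OF finite_carrier, of "{\<zero>, \<one>}"] by simp

lemma pts_coeff: "x \<in> carrier pts \<Longrightarrow> i < d \<Longrightarrow> x i \<in> carrier F"
  and funs_coeff: "u \<in> carrier funs \<Longrightarrow> i \<le> d \<Longrightarrow> u i \<in> carrier F"
  by (auto simp: coord_space_simps PiE_def Pi_def)

lemma dot_closed: "u \<in> carrier funs \<Longrightarrow> x \<in> carrier pts \<Longrightarrow> dot u x \<in> carrier F"
  unfolding dot_def by (intro finsum_closed) (auto simp: pts_coeff funs_coeff)

lemma ev_closed [simp]: "u \<in> carrier funs \<Longrightarrow> x \<in> carrier pts \<Longrightarrow> ev u x \<in> carrier F"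
  by (simp add: ev_def dot_closed funs_coeff)

lemma dot_lin:
  assumes "u \<in> carrier funs" "r \<in> carrier F" "x \<in> carrier pts" "y \<in> carrier pts"
  shows "dot u (r \<odot>\<^bsub>pts\<^esub> x \<oplus>\<^bsub>pts\<^esub> y) = r \<otimes> dot u x \<oplus> dot u y"
proof -
  have "dot u (r \<odot>\<^bsub>pts\<^esub> x \<oplus>\<^bsub>pts\<^esub> y) = (\<Oplus>i\<in>{..<d}. r \<otimes> (u i \<otimes> x i) \<oplus> u i \<otimes> y i)"
    unfolding dot_def using assms
    by (intro finsum_cong')
       (auto simp: coord_space_simps(3,4) pts_coeff funs_coeff r_distr m_lcomm)
  also have "\<dots> = (\<Oplus>i\<in>{..<d}. r \<otimes> (u i \<otimes> x i)) \<oplus> dot u y"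
    unfolding dot_def using assms by (intro finsum_addf) (auto simp: pts_coeff funs_coeff)
  also have "(\<Oplus>i\<in>{..<d}. r \<otimes> (u i \<otimes> x i)) = r \<otimes> dot u x"
    unfolding dot_def using assms
    by (intro finsum_rdistr[symmetric]) (auto simp: pts_coeff funs_coeff)
  finally show ?thesis .
qed

lemma ev_lin:
  assumes "r \<in> carrier F" "u \<in> carrier funs" "w \<in> carrier funs" "x \<in> carrier pts"
  shows "ev (r \<odot>\<^bsub>funs\<^esub> u \<oplus>\<^bsub>funs\<^esub> w) x = r \<otimes> ev u x \<oplus> ev w x"
proof -
  have "dot (r \<odot>\<^bsub>funs\<^esub> u \<oplus>\<^bsub>funs\<^esub> w) x = (\<Oplus>i\<in>{..<d}. r \<otimes> (u i \<otimes> x i) \<oplus> w i \<otimes> x i)"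
    unfolding dot_def using assms
    by (intro finsum_cong')
       (auto simp: coord_space_simps(3,4) pts_coeff funs_coeff l_distr m_assoc)
  also have "\<dots> = (\<Oplus>i\<in>{..<d}. r \<otimes> (u i \<otimes> x i)) \<oplus> dot w x"
    unfolding dot_def using assms by (intro finsum_addf) (auto simp: pts_coeff funs_coeff)
  also have "(\<Oplus>i\<in>{..<d}. r \<otimes> (u i \<otimes> x i)) = r \<otimes> dot u x"
    unfolding dot_def using assms
    by (intro finsum_rdistr[symmetric]) (auto simp: pts_coeff funs_coeff)
  finally have "dot (r \<odot>\<^bsub>funs\<^esub> u \<oplus>\<^bsub>funs\<^esub> w) x = r \<otimes> dot u x \<oplus> dot w x" .
  moreover have "(r \<odot>\<^bsub>funs\<^esub> u \<oplus>\<^bsub>funs\<^esub> w) d = r \<otimes> u d \<oplus> w d"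
    by (simp add: coord_space_simps)
  ultimately show ?thesis
    using assms unfolding ev_def by (simp add: dot_closed funs_coeff r_distr a_ac)
qed

lemma ev_smult:
  assumes "r \<in> carrier F" "u \<in> carrier funs" "x \<in> carrier pts"
  shows "ev (r \<odot>\<^bsub>funs\<^esub> u) x = r \<otimes> ev u x"
proof -
  have "dot \<zero>\<^bsub>funs\<^esub> x = (\<Oplus>i\<in>{..<d}. \<zero>)"
    unfolding dot_def using assms by (intro finsum_cong') (auto simp: coord_space_simps(2) pts_coeff)
  then have "ev \<zero>\<^bsub>funs\<^esub> x = \<zero>" by (simp add: ev_def coord_space_simps(2))
  then show ?thesis using ev_lin[of r u "\<zero>\<^bsub>funs\<^esub>" x] assms by simp
qed

lemma dot_unit:
  assumes "x \<in> carrier pts" "i < d" "\<And>k. k < d \<Longrightarrow> u k = (if i = k then \<one> else \<zero>)"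
  shows "dot u x = x i"
proof -
  have "dot u x = (\<Oplus>k\<in>{..<d}. if i = k then x k else \<zero>)"
    unfolding dot_def using assms by (intro finsum_cong') (auto simp: pts_coeff)
  also have "\<dots> = x i" using assms by (intro finsum_singleton) (auto simp: pts_coeff)
  finally show ?thesis .
qed

lemma ex_dot_eq:
  assumes "u \<in> carrier funs" "i < d" "u i \<noteq> \<zero>" "r \<in> carrier F"
  shows "\<exists>v\<in>carrier pts. dot u v = r"
proof -
  let ?v = "\<lambda>k\<in>{..<d}. if i = k then inv (u i) \<otimes> r else \<zero>"
  have ui: "u i \<in> carrier F" "inv (u i) \<in> carrier F" "u i \<otimes> inv (u i) = \<one>"
    using assms by (auto simp: funs_coeff field_Units)
  have "dot u ?v = (\<Oplus>k\<in>{..<d}. if i = k then r else \<zero>)"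
    unfolding dot_def using assms ui
    by (intro finsum_cong') (auto simp: funs_coeff simp flip: m_assoc)
  also have "\<dots> = r" using assms by (intro finsum_singleton) auto
  finally have "dot u ?v = r" .
  moreover have "?v \<in> carrier pts"
    unfolding coord_space_simps(1) unfolding restrict_PiE_iff using assms(4) ui(2) by simp
  ultimately show ?thesis by blast
qed

text \<open>The zero set is a translate of the kernel of the linear part, by a vector where the
  linear part equals minus the constant term. The dimension of the kernel is read off from its
  cardinality.\<close>

lemma hyperplane_ev:
  assumes u: "u \<in> carrier funs" "i < d" "u i \<noteq> \<zero>"
  shows "hyperplane F d {x \<in> carrier pts. ev u x = \<zero>}"
proof -
  let ?W = "{x \<in> carrier pts. dot u x = \<zero>}"
  have dot0: "dot u \<zero>\<^bsub>pts\<^esub> = \<zero>"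
    using dot_lin[OF u(1), of \<one> "\<zero>\<^bsub>pts\<^esub>" "\<zero>\<^bsub>pts\<^esub>"] dot_closed[OF u(1), of "\<zero>\<^bsub>pts\<^esub>"]
    by (simp add: pts.smult_one)
  have "submodule F ?W pts"
  proof (rule submodule.intro)
    show "module F pts" by (rule pts.module_axioms)
    show "v \<oplus>\<^bsub>pts\<^esub> w \<in> ?W" if "v \<in> ?W" "w \<in> ?W" for v w
      using dot_lin[OF u(1), of \<one> v w] that by (simp add: pts.smult_one)
    show "c \<odot>\<^bsub>pts\<^esub> v \<in> ?W" if "c \<in> carrier F" "v \<in> ?W" for c v
      using dot_lin[OF u(1), of c v "\<zero>\<^bsub>pts\<^esub>"] that dot0 by simp
  qed (auto simp: dot0)
  then have sub: "subspace F ?W pts"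
    by (simp add: subspace_def pts.vectorspace_axioms)
  interpret W: vectorspace F "pts\<lparr>carrier := ?W\<rparr>" by (rule pts.subspace_is_vs[OF sub])
  obtain v1 where v1: "v1 \<in> carrier pts" "dot u v1 = \<one>" using ex_dot_eq[OF u one_closed] by blast
  have "card (carrier pts) = card (carrier F) * card ?W"
    using v1 u by (intro pts.card_eq_card_kernel[of _ _ v1])
       (auto simp: finite_carrier finite_pts dot_closed dot_lin)
  also have "card ?W = card (carrier F) ^ W.dim"
    using W.card_carrier_eq_power_dim finite_carrier finite_pts by simp
  also have "card (carrier pts) = card (carrier F) ^ d" by (rule card_coord_space[OF field_axioms])
  finally have "card (carrier F) ^ d = card (carrier F) ^ Suc W.dim" by simp
  then have dim: "W.dim = d - 1" using two_le_card by (subst (asm) power_inject_exp) auto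
  obtain v where v: "v \<in> carrier pts" "dot u v = \<ominus> u d"
    using ex_dot_eq[OF u, of "\<ominus> u d"] u by (auto simp: funs_coeff)
  have ud: "u d \<in> carrier F" using u by (simp add: funs_coeff)
  have ev_dot: "ev u x = \<zero> \<longleftrightarrow> dot u x = \<ominus> u d" if "x \<in> carrier pts" for x
    using that u ud dot_closed[OF u(1) that] by (metis ev_def l_neg minus_equality)
  have "{x \<in> carrier pts. ev u x = \<zero>} = v <+\<^bsub>pts\<^esub> ?W" (is "?H = _")
  proof (intro subset_antisym subsetI)
    fix x assume x: "x \<in> ?H"
    let ?w = "(\<ominus> \<one>) \<odot>\<^bsub>pts\<^esub> v \<oplus>\<^bsub>pts\<^esub> x"
    have "dot u x = \<ominus> u d" using x ev_dot by auto
    then have "?w \<in> ?W"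
      using v x ud u by (auto simp: dot_lin l_minus r_neg)
    moreover have "x = v \<oplus>\<^bsub>pts\<^esub> ?w"
      using v x by (simp add: pts.smult_l_minus pts.smult_one flip: pts.M.a_assoc)
         (simp add: pts.M.r_neg)
    ultimately show "x \<in> v <+\<^bsub>pts\<^esub> ?W" by (auto simp: a_l_coset_def l_coset_def)
  next
    fix x assume "x \<in> v <+\<^bsub>pts\<^esub> ?W"
    then obtain w where w: "w \<in> ?W" "x = v \<oplus>\<^bsub>pts\<^esub> w" by (auto simp: a_l_coset_def l_coset_def)
    then have "dot u x = \<ominus> u d"
      using dot_lin[OF u(1), of \<one> v w] v ud by (simp add: pts.smult_one)
    then show "x \<in> ?H" using w v ev_dot by auto
  qed
  then show ?thesis
    unfolding hyperplane_def affine_subspace_def using sub dim v by blast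
qed

section \<open>Functions vanishing on a set of points\<close>

lemma finite_ann: "finite (ann S)"
  by (rule finite_subset[OF _ finite_pts[of "Suc d"]]) (auto simp: ann_def)

lemma ann_funs: "u \<in> ann S \<Longrightarrow> u \<in> carrier funs"
  by (simp add: ann_def)

lemma ann_lin:
  assumes "S \<subseteq> carrier pts" "r \<in> carrier F" "u \<in> ann S" "w \<in> ann S"
  shows "r \<odot>\<^bsub>funs\<^esub> u \<oplus>\<^bsub>funs\<^esub> w \<in> ann S"
  using assms by (auto simp: ann_def ev_lin subset_iff)

lemma zero_ann: "S \<subseteq> carrier pts \<Longrightarrow> \<zero>\<^bsub>funs\<^esub> \<in> ann S"
  using ev_smult[of \<zero> "\<zero>\<^bsub>funs\<^esub>"] by (auto simp: ann_def subset_iff)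

lemma ann_insert: "ann (insert x S) = {u \<in> ann S. ev u x = \<zero>}"
  by (auto simp: ann_def)

text \<open>Evaluation at \<open>x\<close> is a linear functional on \<open>ann S\<close> with
  kernel \<open>ann (insert x S)\<close>, so a new point costs at most one factor
  \<open>q\<close>.\<close>

lemma card_ann_le_insert:
  assumes "S \<subseteq> carrier pts" "x \<in> carrier pts"
  shows "card (ann S) \<le> card (carrier F) * card (ann (insert x S))"
  unfolding ann_insert using assms ann_lin finite_ann finite_carrier
  by (intro funs.card_le_card_kernel) (auto simp: ev_lin ann_def)

lemma card_ann_eq_insert:
  assumes "S \<subseteq> carrier pts" "x \<in> carrier pts" "u \<in> ann S" "ev u x \<noteq> \<zero>"
  shows "card (ann S) = card (carrier F) * card (ann (insert x S))"
  unfolding ann_insert using assms ann_lin finite_ann finite_carrier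
  by (intro funs.card_eq_card_kernel[of _ _ u]) (auto simp: ev_lin ann_def)

lemma card_ann_empty: "card (ann {}) = card (carrier F) ^ Suc d"
  using card_coord_space[OF field_axioms, of "Suc d"] by (simp add: ann_def)

lemma card_ann_ge:
  assumes "finite S" "S \<subseteq> carrier pts"
  shows "card (carrier F) ^ Suc d \<le> card (carrier F) ^ card S * card (ann S)"
  using assms
proof (induction S rule: finite_induct)
  case empty
  then show ?case by (simp only: card_ann_empty card.empty power_0 mult_1)
next
  case (insert x S)
  have "card (carrier F) ^ Suc d \<le> card (carrier F) ^ card S * card (ann S)"
    using insert by auto
  also have "\<dots> \<le> card (carrier F) ^ card S * (card (carrier F) * card (ann (insert x S)))"
    using insert by (intro mult_left_mono card_ann_le_insert) auto
  finally show ?case using insert by (simp add: mult_ac)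
qed

text \<open>Distinct points impose independent conditions: the constant function 1
  (\<open>c\<close>) is nonzero at \<open>x\<close>, and a coordinate difference
  \<open>z i - x i\<close> (\<open>u\<close>) vanishes at \<open>x\<close> but not at
  \<open>y\<close>. This starts the count of dependent lists at \<open>S = {x, y}\<close>.\<close>

lemma card_ann_pair:
  assumes "x \<in> carrier pts" "y \<in> carrier pts" "x \<noteq> y" "d > 0"
  shows "card (ann {x, y}) = card (carrier F) ^ (d - 1)"
proof -
  define c where "c = (\<lambda>k\<in>{..<Suc d}. if k = d then \<one> else \<zero>)"
  have c: "c \<in> carrier funs" by (simp add: c_def coord_space_simps(1))
  have "dot c x = (\<Oplus>i\<in>{..<d}. \<zero>)"
    unfolding dot_def using assms by (intro finsum_cong') (auto simp: c_def pts_coeff)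
  then have "ev c x = \<one>" by (simp add: ev_def c_def)
  then have "card (ann {}) = card (carrier F) * card (ann {x})"
    using c assms by (intro card_ann_eq_insert[of _ _ c]) (auto simp: ann_def)
  then have one: "card (ann {x}) = card (carrier F) ^ d"
    using card_ann_empty two_le_card by simp
  obtain i where i: "i < d" "x i \<noteq> y i"
    using assms(1-3) by (metis PiE_ext coord_space_simps(1) lessThan_iff)
  define u where "u = (\<lambda>k\<in>{..<Suc d}. if k = d then \<ominus> x i else if i = k then \<one> else \<zero>)"
  have xy: "x i \<in> carrier F" "y i \<in> carrier F" using assms i by (auto simp: pts_coeff)
  have u: "u \<in> carrier funs"
    unfolding coord_space_simps(1) u_def restrict_PiE_iff using xy by simp
  have "ev u z = z i \<oplus> \<ominus> x i" if "z \<in> carrier pts" for z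
    using dot_unit[OF that i(1), of u] i(1) by (simp add: ev_def u_def)
  then have "ev u x = \<zero>" "ev u y \<noteq> \<zero>" using assms xy i by (auto simp: r_neg dest: sum_zero_eq_neg)
  then have "card (ann {x}) = card (carrier F) * card (ann {y, x})"
    using u assms by (intro card_ann_eq_insert[of _ _ u]) (auto simp: ann_def)
  then have "card (carrier F) ^ d = card (carrier F) * card (ann {x, y})"
    by (simp add: one insert_commute)
  moreover have "card (carrier F) ^ d = card (carrier F) * card (carrier F) ^ (d - 1)"
    using assms(4) by (simp flip: power_Suc)
  ultimately have "card (carrier F) * card (ann {x, y}) = card (carrier F) * card (carrier F) ^ (d - 1)"
    by (simp only:)
  then show ?thesis using two_le_card by simp
qed

text \<open>A nonzero constant has no zeros, so vanishing at \<open>x\<close> rules it out. Only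
  nonconstant functions define hyperplanes.\<close>

lemma ann_nonconstant:
  assumes "x \<in> S" "x \<in> carrier pts" "u \<in> ann S" "u \<noteq> \<zero>\<^bsub>funs\<^esub>"
  shows "\<exists>i<d. u i \<noteq> \<zero>"
proof (rule ccontr)
  assume "\<not> ?thesis"
  then have lin0: "u i = \<zero>" if "i < d" for i using that by blast
  have u: "u \<in> carrier funs" "ev u x = \<zero>" using assms by (auto simp: ann_def)
  have "dot u x = (\<Oplus>i\<in>{..<d}. \<zero>)"
    unfolding dot_def using assms by (intro finsum_cong') (auto simp: lin0 pts_coeff)
  then have "u d = \<zero>" using u funs_coeff[OF u(1), of d] by (simp add: ev_def)
  with lin0 have "u = \<zero>\<^bsub>funs\<^esub>"
    using u(1) funs.M.zero_closed unfolding coord_space_simps(1)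
    by (intro PiE_ext[OF u(1)[unfolded coord_space_simps(1)]])
       (auto simp: coord_space_simps(2) less_Suc_eq)
  with assms show False by simp
qed

text \<open>Two independent functions vanishing on \<open>T\<close> span a pencil of \<open>q + 1\<close> hyperplanes, and
  these cover the space.\<close>

lemma ex_pencil:
  assumes "finite T" "T \<subseteq> carrier pts" "card T \<le> d - 1" "d > 0"
  shows "\<exists>h. (\<forall>x\<in>carrier pts. h x \<in> ann (insert x T) - {\<zero>\<^bsub>funs\<^esub>})
    \<and> card (h ` carrier pts) \<le> card (carrier F) + 1"
proof -
  let ?q = "card (carrier F)"
  \<comment> \<open>The at most \<open>d - 1\<close> points of \<open>T\<close> each cost at most
    one factor of the \<open>q ^ (d + 1)\<close> affine functions. The \<open>q ^ 2\<close> that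
    remain are too many for the multiples of one function, hence two independent ones exist.\<close>
  have "?q ^ card T * ?q ^ 2 \<le> ?q ^ Suc d"
    unfolding power_add[symmetric] using assms two_le_card by (intro power_increasing) auto
  also have "\<dots> \<le> ?q ^ card T * card (ann T)" using card_ann_ge assms by blast
  finally have big: "?q ^ 2 \<le> card (ann T)" using two_le_card by simp
  have qq: "?q < ?q ^ 2" using two_le_card by (simp add: power2_eq_square)
  have "\<not> ann T \<subseteq> {\<zero>\<^bsub>funs\<^esub>}"
  proof
    assume "ann T \<subseteq> {\<zero>\<^bsub>funs\<^esub>}"
    then have "card (ann T) \<le> card {\<zero>\<^bsub>funs\<^esub>}" by (intro card_mono) auto
    with big qq two_le_card show False by simp
  qed
  then obtain \<phi> where \<phi>: "\<phi> \<in> ann T" "\<phi> \<noteq> \<zero>\<^bsub>funs\<^esub>" by blast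
  have "\<not> ann T \<subseteq> (\<lambda>r. r \<odot>\<^bsub>funs\<^esub> \<phi>) ` carrier F"
  proof
    assume "ann T \<subseteq> (\<lambda>r. r \<odot>\<^bsub>funs\<^esub> \<phi>) ` carrier F"
    then have "card (ann T) \<le> card (carrier F)" by (rule surj_card_le[OF finite_carrier])
    with big qq show False by simp
  qed
  then obtain \<psi> where \<psi>: "\<psi> \<in> ann T" "\<psi> \<notin> (\<lambda>r. r \<odot>\<^bsub>funs\<^esub> \<phi>) ` carrier F" by blast
  note ff = ann_funs[OF \<phi>(1)] ann_funs[OF \<psi>(1)]
  \<comment> \<open>The coefficient for which \<open>c x\<close> times \<open>\<phi>\<close> plus
    \<open>\<psi>\<close> vanishes at \<open>x\<close>.\<close>
  define c where "c x = \<ominus> (ev \<psi> x \<otimes> inv (ev \<phi> x))" for x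
  \<comment> \<open>Zeros of \<open>\<phi>\<close> are sent to \<open>\<phi>\<close> itself, the
    member of the pencil at infinity; with the \<open>q\<close> functions \<open>\<psi>\<close> plus
    a multiple of \<open>\<phi>\<close> this gives at most \<open>q + 1\<close> values.\<close>
  define h where "h x = (if ev \<phi> x = \<zero> then \<phi> else c x \<odot>\<^bsub>funs\<^esub> \<phi> \<oplus>\<^bsub>funs\<^esub> \<psi>)" for x
  have inv: "inv (ev \<phi> x) \<in> carrier F" "inv (ev \<phi> x) \<otimes> ev \<phi> x = \<one>"
    if "x \<in> carrier pts" "ev \<phi> x \<noteq> \<zero>" for x
    using that ff by (auto simp: field_Units)
  have c: "c x \<in> carrier F" if "x \<in> carrier pts" "ev \<phi> x \<noteq> \<zero>" for x
    using that ff inv by (simp add: c_def)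
  have "h x \<in> ann (insert x T) - {\<zero>\<^bsub>funs\<^esub>}" if x: "x \<in> carrier pts" for x
  proof (cases "ev \<phi> x = \<zero>")
    case True
    then show ?thesis using \<phi> by (simp add: h_def ann_insert)
  next
    case False
    note cx = c[OF x False] and ix = inv[OF x False]
    let ?u = "c x \<odot>\<^bsub>funs\<^esub> \<phi> \<oplus>\<^bsub>funs\<^esub> \<psi>"
    have "c x \<otimes> ev \<phi> x = \<ominus> (ev \<psi> x)"
      unfolding c_def using ix x ff by (simp add: l_minus m_assoc)
    then have "ev ?u x = \<zero>" using x ff cx by (simp add: ev_lin l_neg)
    moreover have "?u \<in> ann T" using ann_lin assms cx \<phi> \<psi> by blast
    moreover have "?u \<noteq> \<zero>\<^bsub>funs\<^esub>"
    proof
      assume "?u = \<zero>\<^bsub>funs\<^esub>"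
      then have "\<psi> \<oplus>\<^bsub>funs\<^esub> c x \<odot>\<^bsub>funs\<^esub> \<phi> = \<zero>\<^bsub>funs\<^esub>"
        using ff cx by (simp add: funs.M.a_comm)
      then have "\<psi> = \<ominus>\<^bsub>funs\<^esub> (c x \<odot>\<^bsub>funs\<^esub> \<phi>)"
        using ff cx by (intro funs.M.minus_equality[symmetric]) auto
      also have "\<dots> = (\<ominus> c x) \<odot>\<^bsub>funs\<^esub> \<phi>" using ff cx by (simp add: funs.smult_l_minus)
      finally have "\<psi> = (\<ominus> c x) \<odot>\<^bsub>funs\<^esub> \<phi>" .
      then show False using \<psi>(2) cx by blast
    qed
    ultimately show ?thesis using False by (simp add: h_def ann_insert)
  qed
  moreover have "card (h ` carrier pts) \<le> card (carrier F) + 1"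
  proof -
    have "h ` carrier pts \<subseteq> insert \<phi> ((\<lambda>r. r \<odot>\<^bsub>funs\<^esub> \<phi> \<oplus>\<^bsub>funs\<^esub> \<psi>) ` carrier F)"
      using c by (auto simp: h_def)
    then have "card (h ` carrier pts) \<le> card (insert \<phi> ((\<lambda>r. r \<odot>\<^bsub>funs\<^esub> \<phi> \<oplus>\<^bsub>funs\<^esub> \<psi>) ` carrier F))"
      using finite_carrier by (intro card_mono) auto
    also have "\<dots> \<le> Suc (card ((\<lambda>r. r \<odot>\<^bsub>funs\<^esub> \<phi> \<oplus>\<^bsub>funs\<^esub> \<psi>) ` carrier F))"
      using finite_carrier by (intro card_insert_le_m1) auto
    also have "\<dots> \<le> card (carrier F) + 1" using card_image_le[OF finite_carrier] by simp
    finally show ?thesis .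
  qed
  ultimately show ?thesis by blast
qed

text \<open>The zero at \<open>x\<close> makes \<open>u\<close> nonconstant, so its zero set is a
  hyperplane. The point \<open>x\<close> may lie outside \<open>P\<close>.\<close>

lemma general_position_card_zeros:
  assumes "general_position F d P" "finite P" "x \<in> S" "x \<in> carrier pts" "u \<in> ann S" "u \<noteq> \<zero>\<^bsub>funs\<^esub>"
  shows "card {t \<in> P. ev u t = \<zero>} \<le> d"
proof (rule ccontr)
  assume "\<not> ?thesis"
  then have "Suc d \<le> card {t \<in> P. ev u t = \<zero>}" by simp
  then obtain Q where "Q \<subseteq> {t \<in> P. ev u t = \<zero>}" "card Q = Suc d"
    by (rule obtain_subset_with_card_n)
  then have Q: "Q \<subseteq> {t \<in> P. ev u t = \<zero>}" "card Q = d + 1" by simp_all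
  obtain i where i: "i < d" "u i \<noteq> \<zero>" using ann_nonconstant[OF assms(3-6)] by blast
  have "hyperplane F d {x \<in> carrier pts. ev u x = \<zero>}"
    using hyperplane_ev[OF ann_funs[OF assms(5)] i] .
  moreover have "Q \<subseteq> {x \<in> carrier pts. ev u x = \<zero>}" "Q \<subseteq> P"
    using Q assms(1) by (auto simp: general_position_def)
  ultimately show False using assms(1) Q(2) by (auto simp: general_position_def)
qed

text \<open>Adding points one at a time divides the number of functions vanishing on the set by \<open>q\<close>,
  unless the new point is a common zero of the surviving functions, which happens for at most
  \<open>d\<close> points of \<open>A\<close> at each step.\<close>

lemma card_dependent_lists_le:
  assumes A: "general_position F d A" "finite A"
    and "S \<subseteq> carrier pts" "S \<noteq> {}" "card (ann S) = card (carrier F) ^ n"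
  shows "card {ts. length ts = n \<and> set ts \<subseteq> A \<and> (\<exists>u\<in>ann (S \<union> set ts). u \<noteq> \<zero>\<^bsub>funs\<^esub>)}
    \<le> n * d * card A ^ (n - 1)"
  using assms(3-)
proof (induction n arbitrary: S)
  case 0
  \<comment> \<open>Only the zero function is left, so no list is counted.\<close>
  then have "card (ann S) = 1" by simp
  then have "ann S = {\<zero>\<^bsub>funs\<^esub>}" using zero_ann[OF 0(1)] by (auto simp: card_1_singleton_iff)
  then show ?case by simp
next
  case (Suc n)
  let ?B = "\<lambda>n S. {ts. length ts = n \<and> set ts \<subseteq> A \<and> (\<exists>u\<in>ann (S \<union> set ts). u \<noteq> \<zero>\<^bsub>funs\<^esub>)}"
  let ?L = "{ts. set ts \<subseteq> A \<and> length ts = n}"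
  have finL: "finite ?L" using A(2) by (rule finite_lists_length_eq)
  have AV: "A \<subseteq> carrier pts" using A by (simp add: general_position_def)
  obtain x where x: "x \<in> S" "x \<in> carrier pts" using Suc.prems by blast
  have "\<not> ann S \<subseteq> {\<zero>\<^bsub>funs\<^esub>}"
  proof
    assume "ann S \<subseteq> {\<zero>\<^bsub>funs\<^esub>}"
    then have "card (ann S) \<le> card {\<zero>\<^bsub>funs\<^esub>}" by (intro card_mono) auto
    moreover have "1 < card (carrier F) ^ Suc n"
      using two_le_card by (intro one_less_power) auto
    ultimately show False unfolding Suc.prems(3) by simp
  qed
  \<comment> \<open>Any one nonzero \<open>u\<close> serves. A head outside \<open>?Z\<close>
    divides the cardinality by exactly \<open>q\<close>, so the induction hypothesis applies to the
    tail; at most \<open>d\<close> heads lie in \<open>?Z\<close>, and their tails are left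
    unrestricted.\<close>
  then obtain u where u: "u \<in> ann S" "u \<noteq> \<zero>\<^bsub>funs\<^esub>" by blast
  let ?Z = "{t \<in> A. ev u t = \<zero>}"
  have "?B (Suc n) S \<subseteq> (\<lambda>(t, ts). t # ts) ` (?Z \<times> ?L) \<union> (\<Union>t\<in>A - ?Z. Cons t ` ?B n (insert t S))"
  proof
    fix l assume l: "l \<in> ?B (Suc n) S"
    then obtain t ts where tl: "l = t # ts" by (cases l) auto
    show "l \<in> (\<lambda>(t, ts). t # ts) ` (?Z \<times> ?L) \<union> (\<Union>t\<in>A - ?Z. Cons t ` ?B n (insert t S))"
    proof (cases "t \<in> ?Z")
      case True
      then have "(t, ts) \<in> ?Z \<times> ?L" using l tl by auto
      then show ?thesis unfolding tl by (intro UnI1) (rule image_eqI, auto)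
    next
      case False
      have "t \<in> A - ?Z" "ts \<in> ?B n (insert t S)" using l False tl by auto
      then show ?thesis unfolding tl by blast
    qed
  qed
  then have "card (?B (Suc n) S)
      \<le> card ((\<lambda>(t, ts). t # ts) ` (?Z \<times> ?L) \<union> (\<Union>t\<in>A - ?Z. Cons t ` ?B n (insert t S)))"
    using A finL by (intro card_mono) (auto intro!: finite_imageI intro: finite_subset[OF _ finL])
  also have "\<dots> \<le> card ((\<lambda>(t, ts). t # ts) ` (?Z \<times> ?L)) + card (\<Union>t\<in>A - ?Z. Cons t ` ?B n (insert t S))"
    by (rule card_Un_le)
  also have "card ((\<lambda>(t, ts). t # ts) ` (?Z \<times> ?L)) \<le> card (?Z \<times> ?L)"
    using A finL by (intro card_image_le) auto
  also have "\<dots> \<le> d * card A ^ n"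
    using general_position_card_zeros[OF A x u] A
    by (simp add: card_cartesian_product card_lists_length_eq)
  also have "card (\<Union>t\<in>A - ?Z. Cons t ` ?B n (insert t S)) \<le> (\<Sum>t\<in>A - ?Z. card (Cons t ` ?B n (insert t S)))"
    using A by (intro card_UN_le) auto
  also have "\<dots> \<le> (\<Sum>t\<in>A - ?Z. n * d * card A ^ (n - 1))"
  proof (rule sum_mono)
    fix t assume t: "t \<in> A - ?Z"
    have fin: "finite (?B n (insert t S))" by (rule finite_subset[OF _ finL]) auto
    have "card (ann S) = card (carrier F) * card (ann (insert t S))"
      using t AV u Suc.prems by (intro card_ann_eq_insert[of _ _ u]) auto
    then have "card (ann (insert t S)) = card (carrier F) ^ n"
      using Suc.prems two_le_card by simp
    then have "card (?B n (insert t S)) \<le> n * d * card A ^ (n - 1)"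
      using t AV Suc.prems by (intro Suc.IH) auto
    then show "card (Cons t ` ?B n (insert t S)) \<le> n * d * card A ^ (n - 1)"
      using card_image_le[OF fin, of "Cons t"] by linarith
  qed
  also have "\<dots> \<le> card A * (n * d * card A ^ (n - 1))"
    using A by (simp add: card_mono)
  \<comment> \<open>For \<open>n = 0\<close> the truncated exponent is harmless because the factor
    \<open>n\<close> vanishes.\<close>
  also have "\<dots> = n * d * card A ^ n" by (cases n) auto
  finally show ?case by (simp add: algebra_simps)
qed

end

section \<open>Counting general position sets\<close>

lemma choose_add_right_le: "(n choose k) \<le> (n + j) choose (k + j)"
  by (induction j) (simp_all add: trans_le_add1)

text \<open>Up to \<open>m!\<close>, the quotient of \<open>n choose m\<close> by
  \<open>n ^ m\<close> is the product of the factors \<open>(n - i) / n\<close> with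
  \<open>i < m\<close>, none of which decreases as \<open>n\<close> grows.\<close>

lemma choose_mult_power_le:
  assumes "n1 \<le> n2"
  shows "(n1 choose m) * n2 ^ m \<le> (n2 choose m) * n1 ^ m"
proof (induction m)
  case (Suc m)
  have absorb: "Suc m * (n choose Suc m) = (n - m) * (n choose m)" for n
    by (simp only: binomial_absorption binomial_absorb_comp)
  have "(n1 - m) * n2 \<le> (n2 - m) * n1"
  proof (cases "m \<le> n1")
    case True
    have "int ((n1 - m) * n2) \<le> int ((n2 - m) * n1)"
      using True assms by (simp add: of_nat_diff algebra_simps mult_left_mono)
    then show ?thesis by linarith
  qed simp
  then have "((n1 choose m) * n2 ^ m) * ((n1 - m) * n2) \<le> ((n2 choose m) * n1 ^ m) * ((n2 - m) * n1)"
    using Suc.IH by (rule mult_le_mono[rotated])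
  then have "Suc m * ((n1 choose Suc m) * n2 ^ Suc m) \<le> Suc m * ((n2 choose Suc m) * n1 ^ Suc m)"
    using absorb by (simp only: mult.assoc[symmetric]) (simp add: mult_ac)
  then show ?case by (simp only: mult_le_cancel1)
qed simp

text \<open>This absorbs a factor exponential in \<open>m\<close> into the upper index of a
  binomial.\<close>

lemma power_mult_choose_le:
  fixes c :: real
  assumes "c \<ge> 1" "c * real n1 \<le> real n2"
  shows "c ^ m * real (n1 choose m) \<le> real (n2 choose m)"
proof (cases "n1 = 0")
  case True
  then show ?thesis by (cases m) auto
next
  case False
  have "1 * real n1 \<le> c * real n1" using assms by (intro mult_right_mono) auto
  then have le: "n1 \<le> n2" using assms by linarith
  have "(c ^ m * real (n1 choose m)) * real n1 ^ m = real (n1 choose m) * (c * real n1) ^ m"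
    by (simp add: power_mult_distrib)
  also have "\<dots> \<le> real (n1 choose m) * real n2 ^ m"
    using assms by (intro mult_left_mono power_mono) auto
  also have "\<dots> = real ((n1 choose m) * n2 ^ m)" by simp
  also have "\<dots> \<le> real ((n2 choose m) * n1 ^ m)"
    using choose_mult_power_le[OF le] by (simp only: of_nat_le_iff)
  finally show ?thesis using False by simp
qed

text \<open>The count is a falling factorial whose \<open>k\<close> factors all exceed
  \<open>card A - k\<close>, hence are at least half of \<open>card A\<close>.\<close>

lemma card_distinct_lists_ge:
  assumes "finite A" "2 * k \<le> card A"
  shows "(real (card A) / 2) ^ k \<le> real (card {ts. length ts = k \<and> distinct ts \<and> set ts \<subseteq> A})"
proof -
  have "(real (card A) / 2) ^ k = (\<Prod>i\<in>{card A - k + 1..card A}. real (card A) / 2)"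
    using assms by simp
  also have "\<dots> \<le> (\<Prod>i\<in>{card A - k + 1..card A}. real i)"
    using assms by (intro prod_mono) auto
  also have "\<dots> = real (card {ts. length ts = k \<and> distinct ts \<and> set ts \<subseteq> A})"
    using assms by (subst card_lists_distinct_length_eq) (auto simp flip: of_nat_prod)
  finally show ?thesis .
qed

lemma general_position_subset:
  "general_position F d P \<Longrightarrow> A \<subseteq> P \<Longrightarrow> general_position F d A"
  unfolding general_position_def by blast

section \<open>The graph attached to a general position set\<close>

context finite_affine_space
begin

text \<open>For points this says that \<open>x\<close>, \<open>y\<close> and \<open>ts\<close> lie
  in a common hyperplane, since a nonzero function with a zero is nonconstant.\<close>

definition dependent_with :: "(nat \<Rightarrow> 'a) list \<Rightarrow> (nat \<Rightarrow> 'a) \<Rightarrow> (nat \<Rightarrow> 'a) \<Rightarrow> bool" where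
  "dependent_with ts x y \<longleftrightarrow> (\<exists>u\<in>ann ({x, y} \<union> set ts). u \<noteq> \<zero>\<^bsub>funs\<^esub>)"

text \<open>Lists rather than sets, to match the point-by-point count in
  \<open>card_dependent_lists_le\<close>.\<close>

definition spanning_lists :: "(nat \<Rightarrow> 'a) set \<Rightarrow> (nat \<Rightarrow> 'a) list set" where
  "spanning_lists A = {ts. length ts = d - 1 \<and> distinct ts \<and> set ts \<subseteq> A}"

definition adj :: "(nat \<Rightarrow> 'a) set \<Rightarrow> (nat \<Rightarrow> 'a) \<Rightarrow> (nat \<Rightarrow> 'a) \<Rightarrow> bool" where
  "adj A x y \<longleftrightarrow> x \<noteq> y \<and> (\<exists>ts\<in>spanning_lists A. dependent_with ts x y)"

lemma finite_spanning_lists: "finite A \<Longrightarrow> finite (spanning_lists A)"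
  by (rule finite_subset[OF _ finite_lists_length_eq[of A "d - 1"]]) (auto simp: spanning_lists_def)

text \<open>An edge would put \<open>x\<close>, \<open>y\<close> and \<open>d - 1\<close> points of
  \<open>A\<close>, in all \<open>d + 1\<close> distinct points of \<open>P\<close>, into one
  hyperplane.\<close>

lemma not_adj:
  assumes P: "general_position F d P" "finite P" and "A \<subseteq> P" "d > 0"
    and xy: "x \<in> P - A" "y \<in> P - A"
  shows "\<not> adj A x y"
proof
  assume "adj A x y"
  then obtain ts u where ts: "length ts = d - 1" "distinct ts" "set ts \<subseteq> A" and "x \<noteq> y"
    and u: "u \<in> ann ({x, y} \<union> set ts)" "u \<noteq> \<zero>\<^bsub>funs\<^esub>"
    by (auto simp: adj_def spanning_lists_def dependent_with_def)
  have "x \<in> carrier pts" using P xy by (auto simp: general_position_def)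
  then have "card {t \<in> P. ev u t = \<zero>} \<le> d"
    using general_position_card_zeros[OF P _ _ u, of x] by simp
  moreover have "{x, y} \<union> set ts \<subseteq> {t \<in> P. ev u t = \<zero>}"
    using u ts assms by (auto simp: ann_def)
  then have "card ({x, y} \<union> set ts) \<le> card {t \<in> P. ev u t = \<zero>}"
    using P by (intro card_mono) auto
  moreover have "card ({x, y} \<union> set ts) = card {x, y} + card (set ts)"
    using ts xy by (intro card_Un_disjoint) auto
  then have "card ({x, y} \<union> set ts) = 2 + (d - 1)"
    using ts \<open>x \<noteq> y\<close> by (simp add: distinct_card)
  ultimately show False using \<open>d > 0\<close> by linarith
qed

text \<open>Double counting over the spanning lists: there are at least
  \<open>(a / 2) ^ (d - 1)\<close> of them, where \<open>a = card A\<close>, each has a pencil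
  sorting \<open>C\<close> into at most \<open>q + 1\<close> classes, and a pair is joined by at
  most \<open>d\<^sup>2 * a ^ (d - 2)\<close> of them.\<close>

lemma ex_large_adj_degree:
  assumes d: "d \<ge> 2" and A: "general_position F d A" "finite A" "2 * d \<le> card A"
    and C: "C \<subseteq> carrier pts" "real (card C) \<ge> real (card (carrier F)) + 1"
  shows "\<exists>v\<in>C. real (card {y \<in> C. y \<noteq> v \<and> adj A v y})
    \<ge> real (card A) / (2 ^ (d - 1) * (real d)\<^sup>2) * (real (card C) / (real (card (carrier F)) + 1) - 1)"
proof -
  let ?q = "card (carrier F)" and ?a = "card A"
  \<comment> \<open>\<open>?M\<close> is the bound of \<open>card_dependent_lists_le\<close> for
    \<open>n = d - 1\<close>, and \<open>?k\<close> bounds the size of a pencil.\<close>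
  let ?M = "(d - 1) * d * ?a ^ (d - 1 - 1)" and ?k = "card (carrier F) + 1"
  have finC: "finite C" using C finite_pts finite_subset by blast
  have AV: "A \<subseteq> carrier pts" using A by (simp add: general_position_def)
  have pairs: "(card C)\<^sup>2 \<le> ?k * card {(x, y) \<in> C \<times> C. dependent_with ts x y}"
    if "ts \<in> spanning_lists A" for ts
  proof -
    have ts: "set ts \<subseteq> carrier pts" "card (set ts) \<le> d - 1"
      using that AV card_length[of ts] by (auto simp: spanning_lists_def)
    obtain h where h: "\<And>x. x \<in> carrier pts \<Longrightarrow> h x \<in> ann (insert x (set ts)) - {\<zero>\<^bsub>funs\<^esub>}"
      and hk: "card (h ` carrier pts) \<le> ?k"
      using ex_pencil[of "set ts"] ts d by auto
    have "card (h ` C) \<le> card (h ` carrier pts)"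
      using C finite_pts by (intro card_mono) auto
    then have "(card C)\<^sup>2 \<le> ?k * card {(x, y) \<in> C \<times> C. h x = h y}"
      using hk by (intro square_card_le_collisions finC) auto
    also have "\<dots> \<le> ?k * card {(x, y) \<in> C \<times> C. dependent_with ts x y}"
    proof (intro mult_left_mono card_mono)
      show "finite {(x, y) \<in> C \<times> C. dependent_with ts x y}"
        by (rule finite_subset[of _ "C \<times> C"]) (use finC in auto)
      \<comment> \<open>A common value of \<open>h\<close> vanishes at \<open>x\<close>, at
        \<open>y\<close> and on \<open>ts\<close>.\<close>
      show "{(x, y) \<in> C \<times> C. h x = h y} \<subseteq> {(x, y) \<in> C \<times> C. dependent_with ts x y}"
      proof clarify
        fix x y assume xy: "x \<in> C" "y \<in> C" "h x = h y"
        then have "h x \<in> ann ({x, y} \<union> set ts) - {\<zero>\<^bsub>funs\<^esub>}"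
          using h[of x] h[of y] C by (auto simp: ann_def)
        then show "(x, y) \<in> C \<times> C \<and> dependent_with ts x y"
          using xy by (auto simp: dependent_with_def)
      qed
    qed simp
    finally show ?thesis .
  qed
  have mult: "card {ts \<in> spanning_lists A. dependent_with ts x y} \<le> ?M"
    if "x \<in> C" "y \<in> C" "x \<noteq> y" for x y
  proof -
    let ?B = "{ts. length ts = d - 1 \<and> set ts \<subseteq> A \<and> (\<exists>u\<in>ann ({x, y} \<union> set ts). u \<noteq> \<zero>\<^bsub>funs\<^esub>)}"
    have "finite ?B"
      by (rule finite_subset[OF _ finite_lists_length_eq[OF A(2), of "d - 1"]]) auto
    then have "card {ts \<in> spanning_lists A. dependent_with ts x y} \<le> card ?B"
      by (intro card_mono) (auto simp: spanning_lists_def dependent_with_def)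
    also have "\<dots> \<le> ?M"
      using that C d by (intro card_dependent_lists_le A card_ann_pair) auto
    finally show ?thesis .
  qed
  have "C \<noteq> {}" using C by auto
  then obtain v where v: "v \<in> C"
    and deg: "real ?M * real (card {y \<in> C. y \<noteq> v \<and> (\<exists>ts\<in>spanning_lists A. dependent_with ts v y)})
      \<ge> real (card (spanning_lists A)) * (real (card C) / real ?k - 1)"
    using ex_large_degree[OF finite_spanning_lists[OF A(2)] finC _ _ pairs mult] by auto
  let ?deg = "real (card {y \<in> C. y \<noteq> v \<and> adj A v y})"
  let ?X = "real (card C) / (real ?q + 1) - 1"
  \<comment> \<open>Nonnegativity allows the number of lists to be replaced by its lower
    estimate.\<close>
  have X: "?X \<ge> 0" using C by simp
  have "{y \<in> C. y \<noteq> v \<and> (\<exists>ts\<in>spanning_lists A. dependent_with ts v y)} = {y \<in> C. y \<noteq> v \<and> adj A v y}"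
    by (auto simp: adj_def)
  then have deg: "real (card (spanning_lists A)) * ?X \<le> real ?M * ?deg" using deg by (simp add: add.commute)
  have "real ?a ^ (d - 1) / 2 ^ (d - 1) * ?X \<le> real (card (spanning_lists A)) * ?X"
    using card_distinct_lists_ge[OF A(2), of "d - 1"] A(3) X
    by (intro mult_right_mono) (auto simp: spanning_lists_def power_divide)
  also note deg
  also have "real ?M * ?deg \<le> (real d)\<^sup>2 * real ?a ^ (d - 2) * ?deg"
    using d
    by (intro mult_right_mono) (auto simp: power2_eq_square numeral_2_eq_2 intro!: mult_right_mono)
  finally have le: "real ?a ^ (d - 1) / 2 ^ (d - 1) * ?X \<le> (real d)\<^sup>2 * real ?a ^ (d - 2) * ?deg" .
  have "d - 1 = Suc (d - 2)" using d by simp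
  then have "real ?a ^ (d - 1) = real ?a ^ (d - 2) * real ?a" by (simp only: power_Suc2)
  with le have "real ?a ^ (d - 2) * (real ?a / 2 ^ (d - 1) * ?X) \<le> real ?a ^ (d - 2) * ((real d)\<^sup>2 * ?deg)"
    by (simp add: mult_ac)
  then have "real ?a / 2 ^ (d - 1) * ?X \<le> (real d)\<^sup>2 * ?deg"
    using d A(3) by (subst (asm) mult_le_cancel_left_pos) auto
  then have "real ?a / 2 ^ (d - 1) * ?X \<le> ?deg * (real d)\<^sup>2" by (simp only: mult.commute)
  then have "real ?a / 2 ^ (d - 1) * ?X / (real d)\<^sup>2 \<le> ?deg"
    using d by (intro pos_divide_le_eq[THEN iffD2]) simp_all
  then have "real ?a / (2 ^ (d - 1) * (real d)\<^sup>2) * ?X \<le> ?deg" by (simp add: mult_ac)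
  then show ?thesis using v by blast
qed

text \<open>Each \<open>P\<close> is recovered from some \<open>a\<close> of its points, forming
  \<open>A\<close>, and from \<open>P - A\<close>, which is independent in the graph of
  \<open>A\<close>. The bound on \<open>\<beta>\<close> comes from the degree estimate for sets with
  more than \<open>R\<close> points.\<close>

lemma card_general_position_sets_le:
  fixes \<epsilon> \<beta> :: real and a s m :: nat
  defines "q \<equiv> card (carrier F)"
  defines "R \<equiv> nat \<lfloor>(1 + \<epsilon>) * (real q + 1)\<rfloor>"
  assumes d: "d \<ge> 2" and a: "2 * d \<le> a" "a \<le> m" and \<epsilon>: "0 < \<epsilon>" "\<epsilon> \<le> 1"
    and \<beta>: "\<beta> \<le> 1" "\<beta> \<le> real a * \<epsilon> / (2 ^ (d + 1) * (real d)\<^sup>2 * real q)"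
    and s: "real (q ^ d) * (1 - \<beta>) ^ s \<le> real R"
  shows "card (general_position_sets F d m) \<le> (q ^ d + 1) ^ (a + s) * ((R + s + a) choose m)"
proof -
  let ?V = "carrier pts"
  let ?\<A> = "{A. A \<subseteq> ?V \<and> card A = a \<and> general_position F d A}"
  have N: "card ?V = q ^ d" using card_coord_space[OF field_axioms] by (simp add: q_def)
  have q2: "2 \<le> q" using two_le_card by (simp add: q_def)
  have finV: "finite ?V" by (rule finite_pts)
  have indep: "card (indep_sets (adj A) ?V (m - a)) \<le> (q ^ d + 1) ^ s * ((R + s) choose (m - a))"
    if A: "A \<in> ?\<A>" for A
  proof -
    have finA: "finite A" using A finV finite_subset by blast
    have "\<exists>v\<in>C. real (card {y \<in> C. y \<noteq> v \<and> adj A v y}) \<ge> \<beta> * real (card C)"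
      if C: "C \<subseteq> ?V" "R < card C" for C
    proof -
      let ?c = "real (card C)"
      have big: "(1 + \<epsilon>) * (real q + 1) \<le> ?c" using C \<epsilon> unfolding R_def by linarith
      moreover have "1 * (real q + 1) \<le> (1 + \<epsilon>) * (real q + 1)"
        using \<epsilon> by (intro mult_right_mono) auto
      ultimately have "1 * (real q + 1) \<le> ?c" by (rule order.trans[rotated])
      then have "real q + 1 \<le> ?c" by simp
      then obtain v where v: "v \<in> C" "real (card {y \<in> C. y \<noteq> v \<and> adj A v y})
          \<ge> real a / (2 ^ (d - 1) * (real d)\<^sup>2) * (?c / (real q + 1) - 1)"
        using ex_large_adj_degree[OF d _ finA, of C] A a C by (auto simp: q_def)
      \<comment> \<open>The 4 comes from \<open>1 + \<epsilon> \<le> 2\<close> and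
        \<open>q + 1 \<le> 2 * q\<close>; it turns \<open>2 ^ (d - 1)\<close> into the
        \<open>2 ^ (d + 1)\<close> of the hypothesis.\<close>
      have "\<epsilon> * ?c / (4 * real q) \<le> ?c / (real q + 1) - 1"
      proof -
        have "real q + 1 \<le> ?c / (1 + \<epsilon>)" using big \<epsilon> by (simp add: field_simps)
        then have "1 \<le> ?c / (1 + \<epsilon>) / (real q + 1)" by (subst le_divide_eq_1_pos) simp_all
        then have "?c / (real q + 1) - 1 \<ge> ?c / (real q + 1) - ?c / (1 + \<epsilon>) / (real q + 1)" by simp
        also have "?c / (real q + 1) - ?c / (1 + \<epsilon>) / (real q + 1) = \<epsilon> * ?c / ((1 + \<epsilon>) * (real q + 1))"
        proof -
          have "x / p - x / e / p = (e - 1) * x / (e * p)" if "e \<noteq> 0" "p \<noteq> 0" for x p e :: real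
            using that by (simp add: field_simps)
          from this[of "1 + \<epsilon>" "real q + 1" ?c] show ?thesis using \<epsilon> by simp
        qed
        finally have "\<epsilon> * ?c / ((1 + \<epsilon>) * (real q + 1)) \<le> ?c / (real q + 1) - 1" .
        moreover have "\<epsilon> * ?c / (4 * real q) \<le> \<epsilon> * ?c / ((1 + \<epsilon>) * (real q + 1))"
        proof (rule divide_left_mono)
          have "(1 + \<epsilon>) * (real q + 1) \<le> 2 * (2 * real q)"
            using \<epsilon> q2 by (intro mult_mono) auto
          then show "(1 + \<epsilon>) * (real q + 1) \<le> 4 * real q" by simp
        qed (use \<epsilon> q2 in auto)
        ultimately show ?thesis by linarith
      qed
      then have "real a / (2 ^ (d - 1) * (real d)\<^sup>2) * (\<epsilon> * ?c / (4 * real q))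
          \<le> real (card {y \<in> C. y \<noteq> v \<and> adj A v y})"
        using v(2) by (intro order.trans[OF mult_left_mono v(2)]) auto
      moreover have "real a / (2 ^ (d - 1) * (real d)\<^sup>2) * (\<epsilon> * ?c / (4 * real q))
          = real a * \<epsilon> / (2 ^ (d + 1) * (real d)\<^sup>2 * real q) * ?c"
      proof -
        have "(2::real) ^ (d + 1) = 2 ^ (d - 1) * 4"
          using d power_add[of "2::real" "d - 1" 2] by simp
        then show ?thesis by simp
      qed
      moreover have "\<beta> * ?c \<le> real a * \<epsilon> / (2 ^ (d + 1) * (real d)\<^sup>2 * real q) * ?c"
        using \<beta> by (intro mult_right_mono) auto
      ultimately show ?thesis using v(1) by (intro bexI[of _ v]) auto
    qed
    then show ?thesis using card_indep_sets_le[OF finV \<beta>(1), of R "adj A" s "m - a"] s by (simp add: N)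
  qed
  have "general_position_sets F d m \<subseteq> (\<Union>A\<in>?\<A>. (\<lambda>I. A \<union> I) ` indep_sets (adj A) ?V (m - a))"
  proof
    fix P assume "P \<in> general_position_sets F d m"
    then have P: "general_position F d P" "card P = m" "P \<subseteq> ?V"
      by (auto simp: general_position_sets_def general_position_def)
    then have finP: "finite P" using finV finite_subset by blast
    obtain A where A: "A \<subseteq> P" "card A = a" using a(2) P(2) by (metis obtain_subset_with_card_n)
    have "A \<in> ?\<A>" using A P general_position_subset by auto
    moreover have "P - A \<in> indep_sets (adj A) ?V (m - a)"
      using A P finP not_adj[OF P(1) finP A(1)] d finite_subset[OF A(1) finP]
      by (auto simp: indep_sets_def card_Diff_subset)
    moreover have "P = A \<union> (P - A)" using A by auto
    ultimately show "P \<in> (\<Union>A\<in>?\<A>. (\<lambda>I. A \<union> I) ` indep_sets (adj A) ?V (m - a))" by blast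
  qed
  then have "card (general_position_sets F d m)
      \<le> card (\<Union>A\<in>?\<A>. (\<lambda>I. A \<union> I) ` indep_sets (adj A) ?V (m - a))"
    using finV by (intro card_mono) (auto simp: finite_indep_sets)
  also have "\<dots> \<le> (\<Sum>A\<in>?\<A>. card ((\<lambda>I. A \<union> I) ` indep_sets (adj A) ?V (m - a)))"
    using finV by (intro card_UN_le) auto
  also have "\<dots> \<le> (\<Sum>A\<in>?\<A>. (q ^ d + 1) ^ s * ((R + s) choose (m - a)))"
    using finV by (intro sum_mono order.trans[OF card_image_le indep]) (auto simp: finite_indep_sets)
  also have "\<dots> = card ?\<A> * ((q ^ d + 1) ^ s * ((R + s) choose (m - a)))" by simp
  also have "\<dots> \<le> (q ^ d + 1) ^ a * ((q ^ d + 1) ^ s * ((R + s + a) choose m))"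
  proof (intro mult_mono)
    have "card ?\<A> \<le> card {A. A \<subseteq> ?V \<and> card A = a}" using finV by (intro card_mono) auto
    also have "\<dots> = q ^ d choose a" by (simp add: n_subsets finV N)
    also have "\<dots> \<le> (q ^ d) ^ a" by (cases "a \<le> q ^ d") (simp_all add: binomial_le_pow binomial_eq_0)
    also have "\<dots> \<le> (q ^ d + 1) ^ a" by (intro power_mono) auto
    finally show "card ?\<A> \<le> (q ^ d + 1) ^ a" .
    show "(R + s) choose (m - a) \<le> (R + s + a) choose m"
      using choose_add_right_le[of "R + s" "m - a" a] a by simp
  qed auto
  finally show ?thesis by (simp add: power_add mult_ac)
qed

end

section \<open>Choice of parameters and asymptotics\<close>

lemma exp_half_le: "0 \<le> x \<Longrightarrow> x \<le> 1 \<Longrightarrow> exp (x / 2) \<le> 1 + (x::real)"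
proof -
  assume x: "0 \<le> x" "x \<le> 1"
  then have "x * x \<le> 1 * x" by (intro mult_right_mono) auto
  then show ?thesis using exp_bound[of "x / 2"] x by (simp add: power2_eq_square)
qed

text \<open>The case \<open>\<epsilon> = 1 / L\<close>, reduced to inequalities that are checked
  asymptotically later. \<open>T\<close> bounds \<open>a + s\<close>, its 2 covering two roundings
  up. Hypothesis \<open>m\<close> bounds the power of \<open>q ^ d + 1\<close> by
  \<open>(1 + 1 / L) ^ m\<close>; \<open>n2\<close> absorbs this into the binomial, its
  \<open>- 1\<close> covering the floor.\<close>

lemma (in finite_affine_space) card_general_position_sets_le_choose:
  fixes m :: nat
  defines "q \<equiv> card (carrier F)"
  defines "L \<equiv> ln (real q)" and "K \<equiv> 2 ^ (d + 1) * (real d)\<^sup>2"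
  defines "T \<equiv> sqrt (real q) + real d * K * L\<^sup>2 * sqrt (real q) + 2"
  assumes d: "d \<ge> 2"
    and m: "2 * (real d + 1) * L\<^sup>2 * T \<le> real m"
    and n2: "(1 + 1 / L) * ((1 + 1 / L) * (real q + 1) + T) \<le> (1 + \<delta>) * real q - 1"
    and L: "1 \<le> L" and q: "2 * real d \<le> sqrt (real q)"
  shows "card (general_position_sets F d m) \<le> (nat \<lfloor>(1 + \<delta>) * real q\<rfloor> choose m)"
proof -
  \<comment> \<open>Up to logarithms \<open>s\<close> is of order \<open>q / a\<close>, so
    \<open>a\<close> near \<open>sqrt q\<close> balances \<open>a\<close> and
    \<open>s\<close>.\<close>
  define a where "a = nat \<lceil>sqrt (real q)\<rceil>"
  define \<beta> where "\<beta> = 1 / (K * L * sqrt (real q))"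
  \<comment> \<open>Chosen so that \<open>\<beta> * s \<ge> d * L\<close>, which makes
    \<open>(1 - \<beta>) ^ s\<close> at most \<open>1 / q ^ d\<close>.\<close>
  define s where "s = nat \<lceil>real d * K * L\<^sup>2 * sqrt (real q)\<rceil>"
  define R where "R = nat \<lfloor>(1 + 1 / L) * (real q + 1)\<rfloor>"
  define n where "n = nat \<lfloor>(1 + \<delta>) * real q\<rfloor>"
  have floor: "x - 1 \<le> real (nat \<lfloor>x\<rfloor>)" for x :: real by linarith
  have q2: "2 \<le> q" using two_le_card by (simp add: q_def)
  have sq: "1 \<le> sqrt (real q)" using q2 by simp
  have K: "1 \<le> K"
  proof -
    have "1 * 1 \<le> 2 ^ (d + 1) * (real d)\<^sup>2"
      using d by (intro mult_mono one_le_power) auto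
    then show ?thesis by (simp add: K_def)
  qed
  have a: "sqrt (real q) \<le> real a" "real a \<le> sqrt (real q) + 1"
    using sq unfolding a_def by linarith+
  have "0 \<le> real d * K * L\<^sup>2 * sqrt (real q)" using K sq by simp
  then have s: "real d * K * L\<^sup>2 * sqrt (real q) \<le> real s"
      "real s \<le> real d * K * L\<^sup>2 * sqrt (real q) + 1"
    unfolding s_def by linarith+
  have t: "real (a + s) \<le> T" using a s by (simp add: T_def)
  have t_m: "2 * (real d + 1) * L\<^sup>2 * real (a + s) \<le> real m"
    using t by (intro order.trans[OF mult_left_mono m]) auto
  have "1 * 1 * real (a + s) \<le> 2 * (real d + 1) * L\<^sup>2 * real (a + s)"
    using L by (intro mult_right_mono mult_mono) (auto simp: one_le_power)
  with t_m have am: "a \<le> m" by simp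
  have KLs: "1 \<le> K * L * sqrt (real q)"
  proof -
    have "1 * 1 * 1 \<le> K * L * sqrt (real q)" using K L sq by (intro mult_mono) auto
    then show ?thesis by simp
  qed
  have \<beta>1: "\<beta> \<le> 1" using KLs by (simp add: \<beta>_def)
  have "\<beta> = sqrt (real q) / (K * L * real q)"
  proof -
    have "1 / (k * r) = r / (k * (r * r))" if "r \<noteq> 0" for k r :: real using that by simp
    from this[of "sqrt (real q)" "K * L"] show ?thesis using sq by (simp add: \<beta>_def)
  qed
  also have "\<dots> \<le> real a / (K * L * real q)"
    using a K L q2 by (intro divide_right_mono) auto
  finally have \<beta>2: "\<beta> \<le> real a * (1 / L) / (2 ^ (d + 1) * (real d)\<^sup>2 * real q)"
    by (simp add: K_def mult_ac)
  have R1: "1 \<le> real R"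
  proof -
    have "0 \<le> 1 / L * (real q + 1)" using L by simp
    then have "1 \<le> (1 + 1 / L) * (real q + 1)" by (simp add: distrib_right)
    then have "1 \<le> R" unfolding R_def by (intro le_nat_floor) (simp only: of_nat_1)
    then show ?thesis by simp
  qed
  have size: "real (q ^ d) * (1 - \<beta>) ^ s \<le> real R"
  proof -
    have "\<beta> * (real d * K * L\<^sup>2 * sqrt (real q)) \<le> \<beta> * real s"
      using s KLs by (intro mult_left_mono) (auto simp: \<beta>_def)
    moreover have "\<beta> * (real d * K * L\<^sup>2 * sqrt (real q)) = real d * L"
      using KLs K L sq by (simp add: \<beta>_def power2_eq_square)
    ultimately have dL: "real d * L \<le> \<beta> * real s" by simp
    have "(1 - \<beta>) ^ s \<le> exp (- \<beta>) ^ s"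
      using \<beta>1 exp_ge_add_one_self[of "- \<beta>"] by (intro power_mono) auto
    also have "\<dots> = exp (- (\<beta> * real s))" by (simp flip: exp_of_nat_mult add: mult.commute)
    also have "\<dots> \<le> exp (- (real d * L))" using dL by simp
    finally have "real (q ^ d) * (1 - \<beta>) ^ s \<le> real (q ^ d) * exp (- (real d * L))"
      by (intro mult_left_mono) auto
    also have "\<dots> = exp (real d * L) * exp (- (real d * L))"
      using q2 by (simp add: L_def exp_of_nat_mult)
    also have "\<dots> = 1" by (simp flip: exp_add)
    finally show ?thesis using R1 by linarith
  qed
  have "2 * d \<le> a" using a q by linarith
  then have "card (general_position_sets F d m) \<le> (q ^ d + 1) ^ (a + s) * ((R + s + a) choose m)"
    using card_general_position_sets_le[of a m "1 / L" \<beta> s] d am L \<beta>1 \<beta>2 size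
    by (simp add: q_def R_def)
  then have "real (card (general_position_sets F d m))
      \<le> real ((q ^ d + 1) ^ (a + s) * ((R + s + a) choose m))" by (simp only: of_nat_le_iff)
  also have "\<dots> = real ((q ^ d + 1) ^ (a + s)) * real ((R + s + a) choose m)" by simp
  also have "\<dots> \<le> (1 + 1 / L) ^ m * real ((R + s + a) choose m)"
  proof (rule mult_right_mono)
    have "q ^ d + 1 \<le> q ^ Suc d"
    proof -
      have "1 \<le> q ^ d" using q2 by simp
      then have "q ^ d + 1 \<le> 2 * q ^ d" by simp
      also have "\<dots> \<le> q * q ^ d" using q2 by (intro mult_right_mono) auto
      finally show ?thesis by simp
    qed
    then have "(q ^ d + 1) ^ (a + s) \<le> (q ^ Suc d) ^ (a + s)" by (rule power_mono) simp
    then have "real ((q ^ d + 1) ^ (a + s)) \<le> real ((q ^ Suc d) ^ (a + s))"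
      by (simp only: of_nat_le_iff)
    also have "\<dots> = real q ^ (Suc d * (a + s))" by (simp only: power_mult of_nat_power)
    also have "real q = exp L" using q2 by (simp add: L_def)
    also have "exp L ^ (Suc d * (a + s)) = exp (real (Suc d * (a + s)) * L)"
      by (rule exp_of_nat_mult[symmetric])
    \<comment> \<open>The factor 2 in hypothesis \<open>m\<close> supplies the extra half that
      \<open>exp_half_le\<close> needs.\<close>
    also have "\<dots> \<le> exp (real m * (1 / L / 2))"
    proof -
      have "real (Suc d * (a + s)) * L * (2 * L) \<le> real m"
        using t_m by (simp add: power2_eq_square algebra_simps)
      then show ?thesis using L by (simp add: pos_le_divide_eq mult.commute)
    qed
    also have "\<dots> = exp (1 / L / 2) ^ m" by (rule exp_of_nat_mult)
    also have "\<dots> \<le> (1 + 1 / L) ^ m" using L by (intro power_mono exp_half_le) auto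
    finally show "real ((q ^ d + 1) ^ (a + s)) \<le> (1 + 1 / L) ^ m" .
  qed simp
  also have "\<dots> \<le> real (n choose m)"
  proof (rule power_mult_choose_le)
    have "0 \<le> (1 + 1 / L) * (real q + 1)" using L by simp
    then have "real R \<le> (1 + 1 / L) * (real q + 1)" unfolding R_def by (rule of_nat_floor)
    then have "(1 + 1 / L) * real (R + s + a) \<le> (1 + 1 / L) * ((1 + 1 / L) * (real q + 1) + T)"
      using t L by (intro mult_left_mono) auto
    also note n2
    also have "(1 + \<delta>) * real q - 1 \<le> real n" unfolding n_def by (rule floor)
    finally show "(1 + 1 / L) * real (R + s + a) \<le> real n" .
  qed (use L in simp)
  finally show ?thesis by (simp add: n_def)
qed

theorem theorem1p4:
  fixes d :: nat
  assumes "d \<ge> 2"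
  shows "\<exists>\<delta> :: nat \<Rightarrow> real. \<delta> \<longlonglongrightarrow> 0 \<and>
    (\<forall>(q::nat) (F :: 'a ring) (m::nat).
       field F \<and> finite (carrier F) \<and> card (carrier F) = q \<and>
       real m \<ge> real q powr (real d / (real d + 1)) * (log 2 (real q)) ^ 3
       \<longrightarrow> card (general_position_sets F d m) \<le> (nat \<lfloor>(1 + \<delta> q) * real q\<rfloor> choose m))"
proof -
  define K where "K = 2 ^ (d + 1) * (real d)\<^sup>2"
  define T where "T x = sqrt x + real d * K * (ln x)\<^sup>2 * sqrt x + 2" for x
  have c: "real d * K > 0" using assms by (simp add: K_def)
  have d0: "2 * (real d + 1) > 0" by simp
  \<comment> \<open>The left side is of order \<open>sqrt x * (ln x) ^ 4\<close>.\<close>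
  have "\<forall>\<^sub>F x in at_top. 2 * (real d + 1) * (ln x)\<^sup>2 * T x \<le> x powr (2 / 3)"
    unfolding T_def using c d0 by real_asymp
  \<comment> \<open>The square of \<open>1 + 1 / ln x\<close> contributes \<open>2 / ln x\<close> to
    first order and \<open>T x / x\<close> is smaller, so \<open>4 / ln x\<close> leaves
    room.\<close>
  moreover have "\<forall>\<^sub>F x in at_top.
      (1 + 1 / ln x) * ((1 + 1 / ln x) * (x + 1) + T x) \<le> (1 + 4 / ln x) * x - 1"
    unfolding T_def using c by real_asymp
  moreover have "\<forall>\<^sub>F x in at_top. 1 \<le> ln (x :: real)" by real_asymp
  moreover have "\<forall>\<^sub>F x in at_top. 2 * real d \<le> sqrt x" by real_asymp
  ultimately have "\<forall>\<^sub>F x in at_top. 2 * (real d + 1) * (ln x)\<^sup>2 * T x \<le> x powr (2 / 3) \<and>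
      (1 + 1 / ln x) * ((1 + 1 / ln x) * (x + 1) + T x) \<le> (1 + 4 / ln x) * x - 1 \<and>
      1 \<le> ln x \<and> 2 * real d \<le> sqrt x"
    by eventually_elim simp
  then obtain q0 :: nat where q0: "\<And>q. q \<ge> q0 \<Longrightarrow>
      2 * (real d + 1) * (ln (real q))\<^sup>2 * T (real q) \<le> real q powr (2 / 3) \<and>
      (1 + 1 / ln (real q)) * ((1 + 1 / ln (real q)) * (real q + 1) + T (real q))
        \<le> (1 + 4 / ln (real q)) * real q - 1 \<and>
      1 \<le> ln (real q) \<and> 2 * real d \<le> sqrt (real q)"
    using eventually_compose_filterlim[OF _ filterlim_real_sequentially]
    unfolding eventually_sequentially by blast
  \<comment> \<open>Below \<open>q0\<close> the value \<open>q ^ d\<close> raises the upper index to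
    at least the number of points, so counting all \<open>m\<close>-subsets suffices; the limit is
    unaffected.\<close>
  define \<delta> where "\<delta> q = (if q < q0 then real (q ^ d) else 4 / ln (real q))" for q
  have "(\<lambda>q. 4 / ln (real q)) \<longlonglongrightarrow> 0" by real_asymp
  moreover have "\<forall>\<^sub>F q in sequentially. 4 / ln (real q) = \<delta> q"
    using eventually_ge_at_top[of q0] by eventually_elim (simp add: \<delta>_def)
  ultimately have "\<delta> \<longlonglongrightarrow> 0" by (rule Lim_transform_eventually)
  moreover have "card (general_position_sets F d m) \<le> (nat \<lfloor>(1 + \<delta> q) * real q\<rfloor> choose m)"
    if F: "field F" "finite (carrier F)" "card (carrier F) = q"
      and m: "real m \<ge> real q powr (real d / (real d + 1)) * (log 2 (real q)) ^ 3"
    for q m and F :: "'a ring"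
  proof -
    interpret finite_affine_space F d
      by (intro finite_affine_space.intro finite_affine_space_axioms.intro F)
    have q2: "2 \<le> q" using two_le_card F by simp
    show ?thesis
    proof (cases "q < q0")
      case True
      have "general_position_sets F d m \<subseteq> {P. P \<subseteq> carrier pts \<and> card P = m}"
        by (auto simp: general_position_sets_def general_position_def)
      then have "card (general_position_sets F d m) \<le> card {P. P \<subseteq> carrier pts \<and> card P = m}"
        by (intro card_mono) (auto simp: finite_pts)
      also have "\<dots> = q ^ d choose m"
        by (simp add: n_subsets finite_pts card_coord_space F)
      also have "\<dots> \<le> nat \<lfloor>(1 + \<delta> q) * real q\<rfloor> choose m"
      proof (rule binomial_right_mono)
        have "real (q ^ d) * 1 \<le> (1 + real (q ^ d)) * real q"
          using q2 by (intro mult_mono) auto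
        then show "q ^ d \<le> nat \<lfloor>(1 + \<delta> q) * real q\<rfloor>"
          using True by (simp add: \<delta>_def le_nat_floor)
      qed
      finally show ?thesis .
    next
      case False
      \<comment> \<open>For \<open>d \<ge> 2\<close> the exponent \<open>d / (d + 1)\<close> is at
        least \<open>2 / 3\<close>, and the logarithm to base 2 is at least 1.\<close>
      have "real q powr (2 / 3) * 1 \<le> real q powr (real d / (real d + 1)) * (log 2 (real q)) ^ 3"
        using q2 assms
        by (intro mult_mono powr_mono one_le_power) (auto simp: field_simps le_log_iff)
      then have "real q powr (2 / 3) \<le> real m" using m by simp
      then show ?thesis
        using card_general_position_sets_le_choose[of m "\<delta> q"] q0[of q] False assms F
        by (auto simp: \<delta>_def T_def K_def)
    qed
  qed
  ultimately show ?thesis by blast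
qed

end
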